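(* Let $q$ be a complex number with $0<|q|<1$, fix a fifth root $q^{1/5}$ of $q$, and for each positive integer $n$ put $R(q^n):=(q^{1/5})^nT(q^n)$, with $T$ as in the context. Then \begin{align*} &\frac{1}{R(q^{2})R(q^{3})}+R(q^{2})R(q^{3})= 1+\frac{R(q)}{R(q^{6})}+\frac{R(q^{6})}{R(q)},\\ &R(q^{2})=\frac{R^2(q^{4})R(q^{8})-2R(q)R(q^{4})R(q^{16})+R(q^{4})R^2(q^{16})}{R^2(q)R(q^{4})R(q^{8})-2R(q)R(q^{4})R(q^{8})R(q^{16})+R^2(q)R^2(q^{16})},\\ &R(q^6)= R(q)R^2(q^2)R(q^3)\cdot\frac{R(q)R(q^2)-R(q^3)+R^3(q)}{R^2(q)R(q^3)-R(q^2)R(q^3)+R^3(q)R(q^2)},\\ &R(q^2)=\frac{R(q)R(q^3)}{R(q^6)}\cdot\frac{R(q) R^2(q^3) R(q^6)+2 R(q^6) R(q^{12})+ R(q) R(q^3) R^2(q^{12})}{R(q^3) R(q^6)+2 R(q) R^2(q^3) R(q^{12})+ R^2(q^{12})},\\ &R(q^2)=\frac{1}{R(q)R(q^3)R(q^6)}\\ &\qquad\times\frac{2 R(q)R(q^3)R(q^6)R(q^{24})-R(q^4)R(q^6)R^2(q^{12})-R(q^4)R(q^{12})R^2(q^{24})}{R(q)R(q^3)R(q^6)R(q^{12})-2 R(q^4)R^2(q^{12})R(q^{24})+R(q)R(q^3)R^2(q^{24})}. \end{align*}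
   Context: For complex $a$ and $|q|<1$, $(a;q)_\infty:=\prod_{k=0}^{\infty}(1-aq^k)$. The Rogers–Ramanujan functions are $G(q):=\frac{1}{(q;q^5)_\infty(q^4;q^5)_\infty}$ and $H(q):=\frac{1}{(q^2;q^5)_\infty(q^3;q^5)_\infty}$, and $T(q):=\frac{H(q)}{G(q)}=\frac{(q;q^5)_\infty(q^4;q^5)_\infty}{(q^2;q^5)_\infty(q^3;q^5)_\infty}$. The Rogers–Ramanujan continued fraction satisfies $R(q)=q^{1/5}T(q)$; in the statement $R(q^n)$ means $(q^{1/5})^nT(q^n)$ for the fixed choice of $q^{1/5}$, and $R^k(x)$ means $(R(x))^k$. *)

theory Defs
  imports "HOL-Analysis.Analysis"
begin

definition qpoch_inf :: "complex \<Rightarrow> complex \<Rightarrow> complex" where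
  "qpoch_inf a q = (\<Prod>k. 1 - a * q ^ k)"

definition rr_G :: "complex \<Rightarrow> complex" where
  "rr_G q = 1 / (qpoch_inf q (q ^ 5) * qpoch_inf (q ^ 4) (q ^ 5))"

definition rr_H :: "complex \<Rightarrow> complex" where
  "rr_H q = 1 / (qpoch_inf (q ^ 2) (q ^ 5) * qpoch_inf (q ^ 3) (q ^ 5))"

definition rr_T :: "complex \<Rightarrow> complex" where
  "rr_T q = rr_H q / rr_G q"

(* The value R(q^n) of the Rogers-Ramanujan continued fraction, where r is the chosen fifth
   root of q. The fifth root of q^n used here is r^n, not a separately chosen one, so the
   value depends on r and not only on q^n. *)
definition rr_R :: "complex \<Rightarrow> complex \<Rightarrow> nat \<Rightarrow> complex" where
  "rr_R r q n = r ^ n * rr_T (q ^ n)"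

end

theory Submission
  imports Defs "HOL-Complex_Analysis.Complex_Analysis"
begin

text \<open>
  All five identities are algebraic consequences of the modular equations relating $R(q)$ to
  $R(q^2)$ and to $R(q^3)$.  These two follow from Weierstrass' three-term relation and a cubic
  analogue of it for the theta function $\theta(x;p) = (x;p)_\infty (p/x;p)_\infty$, which are
  proved by a Liouville argument in the variable $x$.

  Eliminating with the modular equations gives each further relation $F = 0$ only in the form
  $G F = 0$.  Both factors are holomorphic in $r = q^{1/5}$ on the unit disc and $G \neq 0$ at
  $r = 0$, so the identity theorem selects the branch $F = 0$.

  The denominators have no zeros: a zero would force $x^2 + 11x - 1 = 0$ for $x = R(q^n)^5$ with some
  $n$, which the equation of degree two propagates to $R(q^{2n})^5$, $R(q^{4n})^5$, and so on,
  whereas these values tend to $0$.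
\<close>

section \<open>The infinite q-Pochhammer symbol\<close>

text \<open>The values R(q^n) = r^n T(r^(5n)) all vanish at r = 0, so a polynomial cofactor can be
  discarded as soon as its constant term is nonzero. One relation resists: the one expressing R(q^4)
  rationally through R(q), R(q^3), R(q^6), R(q^12) comes with a cofactor that vanishes at 0, and
  R(q) R(q^2) has to be divided out of it first.

  Identities two, four and five share a pattern. Cleared of denominators, each is a quadratic
  polynomial in the value of highest level, proportional to the quadratic equation which that value
  satisfies over lower levels.

  Division by zero yields 0 and no R(q^n) is 0, so an identity could not survive a vanishing
  denominator. The cleared identity makes the numerator vanish as well, and two vanishing conditions
  together with the modular equations are overdetermined: this is where x^2 + 11x - 1 arises.
  Classically 1/R(q)^5 - 11 - R(q)^5 is an infinite product without zeros; the propagation argument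
  gets by without that product.\<close>

lemma convergent_prod_qpoch:
  fixes a q :: complex
  assumes "norm q < 1"
  shows "convergent_prod (\<lambda>k. 1 - a * q ^ k)"
proof -
  have "summable (\<lambda>k. norm a * norm q ^ k)"
    using assms by (intro summable_mult summable_geometric) auto
  then show ?thesis
    by (intro abs_convergent_prod_imp_convergent_prod summable_imp_abs_convergent_prod)
       (simp add: norm_mult norm_power)
qed

lemma qpoch_inf_tendsto:
  assumes "norm q < 1"
  shows "(\<lambda>n. \<Prod>k<n. 1 - a * q ^ k) \<longlonglongrightarrow> qpoch_inf a q"
  unfolding qpoch_inf_def
  by (rule has_prod_imp_tendsto'[OF convergent_prod_has_prod[OF convergent_prod_qpoch[OF assms]]])

lemma qpoch_inf_0_left [simp]: "qpoch_inf 0 q = 1"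
  by (simp add: qpoch_inf_def)

lemma qpoch_inf_rec:
  assumes "norm q < 1"
  shows "qpoch_inf a q = (1 - a) * qpoch_inf (a * q) q"
proof -
  have "(\<lambda>k. 1 - a * q ^ k) has_prod ((\<Prod>k<1. 1 - a * q ^ k) * (\<Prod>k. 1 - a * q ^ (k + 1)))"
    by (rule has_prod_ignore_initial_segment'[OF convergent_prod_qpoch[OF assms]])
  then have "qpoch_inf a q = (1 - a) * (\<Prod>k. 1 - a * q ^ (k + 1))"
    using has_prod_unique unfolding qpoch_inf_def by fastforce
  then show ?thesis
    by (simp add: qpoch_inf_def mult_ac)
qed

lemma qpoch_inf_eq_0_iff:
  assumes "norm q < 1"
  shows "qpoch_inf a q = 0 \<longleftrightarrow> (\<exists>k. a * q ^ k = 1)"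
proof
  assume "qpoch_inf a q = 0"
  then show "\<exists>k. a * q ^ k = 1"
    using prodinf_nonzero[OF convergent_prod_qpoch[OF assms, of a]]
    unfolding qpoch_inf_def by (metis eq_iff_diff_eq_0)
next
  assume "\<exists>k. a * q ^ k = 1"
  then obtain k where "a * q ^ k = 1" by blast
  then have "0 \<in> range (\<lambda>k. 1 - a * q ^ k)"
    by (intro image_eqI[of _ _ k]) auto
  then show "qpoch_inf a q = 0"
    unfolding qpoch_inf_def
    using has_prod_eq_0_iff[OF convergent_prod_has_prod[OF convergent_prod_qpoch[OF assms, of a]]]
    by blast
qed

text \<open>The factors are sorted by the residue of the exponent modulo \<open>m\<close>. This is
  exact on partial products of length \<open>n * m\<close>, which form a subsequence of all partial
  products.\<close>

lemma qpoch_inf_split: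
  assumes "norm q < 1" and "m > 0"
  shows "qpoch_inf a q = (\<Prod>i<m. qpoch_inf (a * q ^ i) (q ^ m))"
proof -
  have qm: "norm (q ^ m) < 1"
    using assms by (simp add: norm_power power_less_one_iff)
  have eq: "(\<Prod>k<n * m. 1 - a * q ^ k) = (\<Prod>i<m. \<Prod>j<n. 1 - (a * q ^ i) * (q ^ m) ^ j)" for n
  proof -
    have "(\<Prod>k<n * m. 1 - a * q ^ k) = (\<Prod>j<n. \<Prod>k\<in>{j * m..<j * m + m}. 1 - a * q ^ k)"
      using prod.nat_group[of "\<lambda>k. 1 - a * q ^ k" m n] by simp
    also have "\<dots> = (\<Prod>j<n. \<Prod>i<m. 1 - (a * q ^ i) * (q ^ m) ^ j)"
    proof (rule prod.cong[OF refl])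
      fix j
      have "(\<Prod>k\<in>{j * m..<j * m + m}. 1 - a * q ^ k) = (\<Prod>i\<in>{0..<m}. 1 - a * q ^ (i + j * m))"
        using prod.shift_bounds_nat_ivl[of "\<lambda>k. 1 - a * q ^ k" 0 "j * m" m] by (simp add: add.commute)
      also have "\<dots> = (\<Prod>i<m. 1 - (a * q ^ i) * (q ^ m) ^ j)"
        by (intro prod.cong) (auto simp: power_add power_mult[symmetric] mult_ac)
      finally show "(\<Prod>k\<in>{j * m..<j * m + m}. 1 - a * q ^ k)
          = (\<Prod>i<m. 1 - (a * q ^ i) * (q ^ m) ^ j)" .
    qed
    also have "\<dots> = (\<Prod>i<m. \<Prod>j<n. 1 - (a * q ^ i) * (q ^ m) ^ j)"
      by (rule prod.swap)
    finally show ?thesis .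
  qed
  have "(\<lambda>n. \<Prod>k<n * m. 1 - a * q ^ k) \<longlonglongrightarrow> qpoch_inf a q"
    using LIMSEQ_subseq_LIMSEQ[OF qpoch_inf_tendsto[OF assms(1), of a], of "\<lambda>n. n * m"] assms(2)
    by (simp add: o_def strict_mono_def)
  moreover have "(\<lambda>n. \<Prod>k<n * m. 1 - a * q ^ k)
      \<longlonglongrightarrow> (\<Prod>i<m. qpoch_inf (a * q ^ i) (q ^ m))"
    unfolding eq by (intro tendsto_prod qpoch_inf_tendsto qm)
  ultimately show ?thesis
    by (rule LIMSEQ_unique)
qed

text \<open>Both arguments vary because G and H have nome q^5 and not a fixed one. On a small closed
  disc the maximum of the norm of \<open>g\<close> is attained, hence below 1, and gives a single
  geometric majorant for the Weierstrass test.\<close>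

lemma holomorphic_on_qpoch_inf [holomorphic_intros]:
  assumes f: "f holomorphic_on A" and g: "g holomorphic_on A" and "open A"
    and "\<And>z. z \<in> A \<Longrightarrow> norm (g z) < 1"
  shows "(\<lambda>z. qpoch_inf (f z) (g z)) holomorphic_on A"
proof (rule holomorphic_uniform_sequence[OF \<open>open A\<close>])
  show "(\<lambda>z. \<Prod>k<n. 1 - f z * g z ^ k) holomorphic_on A" for n
    by (intro holomorphic_intros f g)
next
  fix x assume "x \<in> A"
  then obtain d where d: "d > 0" "cball x d \<subseteq> A"
    using \<open>open A\<close> open_contains_cball by blast
  have cont: "continuous_on (cball x d) f" "continuous_on (cball x d) g"
    using f g d(2) by (meson continuous_on_subset holomorphic_on_imp_continuous_on)+
  have "compact (f ` cball x d)"
    using compact_continuous_image[OF cont(1)] by simp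
  then obtain M where M: "\<And>z. z \<in> cball x d \<Longrightarrow> norm (f z) \<le> M"
    using compact_imp_bounded bounded_iff by (metis image_eqI)
  have "continuous_on (cball x d) (\<lambda>z. norm (g z))"
    using cont by (intro continuous_intros)
  then obtain y where y: "y \<in> cball x d" "\<And>z. z \<in> cball x d \<Longrightarrow> norm (g z) \<le> norm (g y)"
    using continuous_attains_sup[of "cball x d" "\<lambda>z. norm (g z)"] d(1) by auto
  have gy: "norm (g y) < 1"
    using y(1) d(2) assms(4) by blast
  have "uniformly_convergent_on (cball x d) (\<lambda>n z. \<Prod>k<n. 1 - f z * g z ^ k)"
  proof (rule uniformly_convergent_on_prod')
    show "continuous_on (cball x d) (\<lambda>z. 1 - f z * g z ^ k)" for k
      by (intro continuous_intros cont)
    show "uniformly_convergent_on (cball x d) (\<lambda>N z. \<Sum>n<N. norm (1 - f z * g z ^ n - 1))"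
    proof (rule Weierstrass_m_test')
      show "norm (norm (1 - f z * g z ^ n - 1)) \<le> M * norm (g y) ^ n" if "z \<in> cball x d" for n z
        using M[OF that] y(2)[OF that]
        by (auto simp: norm_mult norm_power intro!: mult_mono power_mono)
           (meson norm_ge_zero order_trans)
      show "summable (\<lambda>n. M * norm (g y) ^ n)"
        using gy by (intro summable_mult summable_geometric) auto
    qed
  qed simp
  then obtain l where l: "uniform_limit (cball x d) (\<lambda>n z. \<Prod>k<n. 1 - f z * g z ^ k) l sequentially"
    unfolding uniformly_convergent_on_def by blast
  have "l z = qpoch_inf (f z) (g z)" if "z \<in> cball x d" for z
    using tendsto_uniform_limitI[OF l that] qpoch_inf_tendsto[of "g z" "f z"] assms(4) d(2) that
    by (meson LIMSEQ_unique subsetD)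
  then have "uniform_limit (cball x d) (\<lambda>n z. \<Prod>k<n. 1 - f z * g z ^ k)
      (\<lambda>z. qpoch_inf (f z) (g z)) sequentially"
    by (intro iffD1[OF uniform_limit_cong' l]) auto
  then show "\<exists>d>0. cball x d \<subseteq> A \<and> uniform_limit (cball x d)
      (\<lambda>n z. \<Prod>k<n. 1 - f z * g z ^ k) (\<lambda>z. qpoch_inf (f z) (g z)) sequentially"
    using d by blast
qed

section \<open>The multiplicative theta function\<close>

text \<open>The modified Jacobi theta function: the Jacobi triple product without its constant
  factor \<open>qpoch_inf p p\<close>.\<close>

definition theta :: "complex \<Rightarrow> complex \<Rightarrow> complex" where
  "theta x p = qpoch_inf x p * qpoch_inf (p / x) p"

lemma theta_mult_nome:
  assumes "norm p < 1" "p \<noteq> 0" "x \<noteq> 0"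
  shows "theta (p * x) p = - theta x p / x"
proof -
  have "qpoch_inf x p = (1 - x) * qpoch_inf (p * x) p"
    using qpoch_inf_rec[OF assms(1), of x] by (simp add: mult.commute)
  moreover have "qpoch_inf (1 / x) p = (1 - 1 / x) * qpoch_inf (p / x) p"
    using qpoch_inf_rec[OF assms(1), of "1 / x"] by simp
  ultimately show ?thesis
    using assms(2,3) by (simp add: theta_def) (simp add: field_simps)
qed

lemma theta_inverse:
  assumes "norm p < 1" "p \<noteq> 0" "x \<noteq> 0"
  shows "theta (1 / x) p = - theta x p / x"
  using theta_mult_nome[OF assms] assms by (simp add: theta_def mult_ac)

lemma theta_reflect: "p \<noteq> 0 \<Longrightarrow> theta (p / x) p = theta x p"
  by (cases "x = 0") (simp_all add: theta_def mult_ac)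

lemma theta_eq_0_iff:
  assumes "norm p < 1" "p \<noteq> 0" "x \<noteq> 0"
  shows "theta x p = 0 \<longleftrightarrow> (\<exists>n. x = p powi n)"
proof
  assume "theta x p = 0"
  then consider k where "x * p ^ k = 1" | k where "p / x * p ^ k = 1"
    unfolding theta_def using qpoch_inf_eq_0_iff[OF assms(1)] by auto
  then show "\<exists>n. x = p powi n"
  proof cases
    case 1
    then have "x = p powi (- int k)"
      using assms by (simp add: power_int_minus field_simps)
    then show ?thesis by blast
  next
    case 2
    then have "x = p ^ Suc k"
      using assms by (simp add: field_simps)
    then have "x = p powi (int (Suc k))"
      by (simp only: power_int_of_nat)
    then show ?thesis by blast
  qed
next
  assume "\<exists>n. x = p powi n"
  then obtain n where n: "x = p powi n" by blast
  show "theta x p = 0"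
  proof (cases "n \<ge> 1")
    case True
    then have "x = p ^ Suc (nat n - 1)"
      unfolding n by (simp add: power_int_def)
    then have "p / x * p ^ (nat n - 1) = 1"
      using assms by simp
    then show ?thesis
      unfolding theta_def using qpoch_inf_eq_0_iff[OF assms(1)] by auto
  next
    case False
    then have "x = inverse p ^ nat (- n)"
      unfolding n by (cases "n = 0") (auto simp: power_int_def)
    then have "x * p ^ nat (- n) = 1"
      using assms(2) by (simp flip: power_mult_distrib)
    then show ?thesis
      unfolding theta_def using qpoch_inf_eq_0_iff[OF assms(1)] by auto
  qed
qed

lemma theta_1 [simp]: "norm p < 1 \<Longrightarrow> theta 1 p = 0"
  using qpoch_inf_eq_0_iff[of p 1] by (auto simp: theta_def intro: exI[of _ 0])

lemma holomorphic_on_theta [holomorphic_intros]: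
  assumes f: "f holomorphic_on A" and "open A" and "\<And>z. z \<in> A \<Longrightarrow> f z \<noteq> 0" and "norm p < 1"
  shows "(\<lambda>z. theta (f z) p) holomorphic_on A"
  unfolding theta_def using assms by (intro holomorphic_intros) auto

lemma theta_split:
  assumes "norm p < 1" and "m > 0" and "p \<noteq> 0"
  shows "theta x p = (\<Prod>i<m. theta (x * p ^ i) (p ^ m))"
proof -
  have "qpoch_inf (p / x) p = (\<Prod>i<m. qpoch_inf (p / x * p ^ i) (p ^ m))"
    by (rule qpoch_inf_split[OF assms(1,2)])
  \<comment> \<open>Reversing the order of the residues pairs the factor of p^m / (x p^i) with that
    of x p^i.\<close>
  also have "\<dots> = (\<Prod>i<m. qpoch_inf (p / x * p ^ (m - Suc i)) (p ^ m))"
    by (rule prod.nat_diff_reindex[symmetric])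
  also have "\<dots> = (\<Prod>i<m. qpoch_inf (p ^ m / (x * p ^ i)) (p ^ m))"
  proof (rule prod.cong[OF refl])
    fix i assume "i \<in> {..<m}"
    then have "p ^ m = p ^ Suc (m - Suc i) * p ^ i"
      unfolding power_add[symmetric] by (intro arg_cong[of _ _ "\<lambda>k. p ^ k"]) auto
    then have "p / x * p ^ (m - Suc i) = p ^ m / (x * p ^ i)"
      using assms(3) by (simp add: field_simps)
    then show "qpoch_inf (p / x * p ^ (m - Suc i)) (p ^ m) = qpoch_inf (p ^ m / (x * p ^ i)) (p ^ m)"
      by simp
  qed
  finally show ?thesis
    by (simp add: theta_def qpoch_inf_split[OF assms(1,2), of x] prod.distrib)
qed

text \<open>The factor 1 - x splits off, so only the value at 1 of the complementary factor
  \<open>?K\<close> contributes.\<close>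

lemma theta_deriv_1:
  assumes "norm p < 1" "p \<noteq> 0"
  shows "((\<lambda>x. theta x p) has_field_derivative - (qpoch_inf p p)\<^sup>2) (at 1)"
proof -
  let ?K = "\<lambda>x. qpoch_inf (x * p) p * qpoch_inf (p / x) p"
  have "?K holomorphic_on - {0}"
    using assms by (intro holomorphic_intros) auto
  then have "?K field_differentiable at 1"
    by (rule holomorphic_on_imp_differentiable_at) auto
  then obtain D where "(?K has_field_derivative D) (at 1)"
    unfolding field_differentiable_def by blast
  from DERIV_mult[OF DERIV_diff[OF DERIV_const[of 1] DERIV_ident] this]
  have "((\<lambda>x. (1 - x) * ?K x) has_field_derivative - (qpoch_inf p p)\<^sup>2) (at 1)"
    by (simp add: power2_eq_square)
  moreover have "(1 - x) * ?K x = theta x p" for x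
    using qpoch_inf_rec[OF assms(1), of x] by (simp add: theta_def mult.assoc)
  ultimately show ?thesis
    by simp
qed

lemma qpoch_inf_nome_nonzero:
  assumes "norm p < 1"
  shows "qpoch_inf p p \<noteq> 0"
proof -
  have "norm (p * p ^ k) < 1" for k
    using assms by (simp add: norm_power power_less_one_iff flip: power_Suc)
  then show ?thesis
    unfolding qpoch_inf_eq_0_iff[OF assms] by (metis norm_one less_irrefl)
qed

text \<open>The zeros are the integer powers of p. The zero at 1 is simple, and differentiating the
  functional equation carries this to all the others in both directions.\<close>

lemma theta_deriv_zero_nonzero:
  assumes p: "norm p < 1" "p \<noteq> 0" and x: "x \<noteq> 0" and zero: "theta x p = 0"
  shows "deriv (\<lambda>x. theta x p) x \<noteq> 0"
proof -
  let ?t = "\<lambda>x. theta x p"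
  have hol: "?t holomorphic_on - {0}"
    using p by (intro holomorphic_intros) auto
  have der: "(?t has_field_derivative deriv ?t z) (at z)" if "z \<noteq> 0" for z
    using holomorphic_derivI[OF hol, of z] that by auto
  \<comment> \<open>At a zero the term coming from the derivative of 1/z drops out.\<close>
  have shift: "deriv ?t (p * z) = - deriv ?t z / (p * z)" if z: "z \<noteq> 0" "?t z = 0" for z
  proof -
    have 1: "((\<lambda>z. ?t (p * z)) has_field_derivative deriv ?t (p * z) * p) (at z)"
      by (rule DERIV_chain2[where g = "\<lambda>z. p * z"])
         (use z p in \<open>auto intro!: der derivative_eq_intros\<close>)
    have 2: "((\<lambda>z. - ?t z / z) has_field_derivative - deriv ?t z / z) (at z)"
      using der[of z] z by (auto intro!: derivative_eq_intros simp: field_simps)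
    have "((\<lambda>z. ?t (p * z)) has_field_derivative - deriv ?t z / z) (at z)"
    proof (rule has_field_derivative_transform_within_open[OF 2])
      show "open (- {0::complex})" by auto
    qed (use z p theta_mult_nome in auto)
    from DERIV_unique[OF 1 this] show ?thesis
      using z p by (simp add: field_simps)
  qed
  have nz: "p powi n \<noteq> 0" for n using p by simp
  have thz: "?t (p powi n) = 0" for n
    using theta_eq_0_iff[OF p nz] by blast
  have "deriv ?t (p powi n) \<noteq> 0" for n
  proof (induction n rule: int_induct[where k = 0])
    case base
    show ?case
      using DERIV_imp_deriv[OF theta_deriv_1[OF p]] qpoch_inf_nome_nonzero[OF p(1)] by simp
  next
    case (step1 i)
    then show ?case
      using shift[OF nz thz, of i] p nz by (simp add: power_int_add mult_ac)
  next
    case (step2 i)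
    have "p * p powi (i - 1) = p powi i"
      using p by (simp add: power_int_diff)
    then show ?case
      using shift[OF nz thz, of "i - 1"] step2 by auto
  qed
  then show ?thesis
    using theta_eq_0_iff[OF p x] zero by auto
qed

section \<open>Quasi-periodic functions\<close>

lemma quasi_periodic_zero:
  fixes f :: "complex \<Rightarrow> complex"
  assumes "p \<noteq> 0"
    and qp: "\<And>x. x \<noteq> 0 \<Longrightarrow> f (p * x) = m x * f x" "\<And>x. x \<noteq> 0 \<Longrightarrow> m x \<noteq> 0"
    and "z \<noteq> 0" "f z = 0"
  shows "f (p powi n * z) = 0"
proof (induction n rule: int_induct[where k = 0])
  case (step1 i)
  then show ?case
    using qp(1)[of "p powi i * z"] assms(1,4) by (simp add: power_int_add mult_ac)
next
  case (step2 i)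
  have "p * (p powi (i - 1) * z) = p powi i * z"
    using assms(1) by (simp add: power_int_diff)
  then show ?case
    using qp[of "p powi (i - 1) * z"] step2.IH assms(1,4)
    by (metis mult_eq_0_iff power_int_eq_0_iff)
qed (use assms in auto)

text \<open>At a zero of \<open>g\<close> the quotient is given its limit, the ratio of the
  derivatives; this makes it continuous, so the singularity is removable. Isolatedness of the zeros
  is stated separately because it also lets functional equations of the quotient extend by
  continuity.\<close>

lemma holomorphic_quotient_simple_zeros:
  assumes hol: "f holomorphic_on A" "g holomorphic_on A" and A: "open A"
    and zero: "\<And>x. x \<in> A \<Longrightarrow> g x = 0 \<Longrightarrow> f x = 0 \<and> deriv g x \<noteq> 0"
  shows "(\<lambda>x. if g x = 0 then deriv f x / deriv g x else f x / g x) holomorphic_on A"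
    and "z \<in> A \<Longrightarrow> eventually (\<lambda>x. g x \<noteq> 0) (at z)"
proof -
  let ?h = "\<lambda>x. if g x = 0 then deriv f x / deriv g x else f x / g x"
  show ev: "eventually (\<lambda>x. g x \<noteq> 0) (at z)" if z: "z \<in> A" for z
  proof (cases "g z = 0")
    case True
    have "(g has_field_derivative deriv g z) (at z)"
      using holomorphic_derivI[OF hol(2) A z] .
    then have "((\<lambda>x. (g x - g z) / (x - z)) \<longlongrightarrow> deriv g z) (at z)"
      by (simp add: has_field_derivative_iff)
    then have "eventually (\<lambda>x. (g x - g z) / (x - z) \<noteq> 0) (at z)"
      using zero[OF z True] by (intro tendsto_imp_eventually_ne) auto
    then show ?thesis
      using True by (auto elim!: eventually_mono)
  next
    case False
    have "isCont g z"
      using hol(2) A z by (meson continuous_on_eq_continuous_at holomorphic_on_imp_continuous_on)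
    then show ?thesis
      using False by (intro tendsto_imp_eventually_ne) (auto simp: isCont_def)
  qed
  have "?h analytic_on {z}" if z: "z \<in> A" for z
  proof -
    have "eventually (\<lambda>x. x \<in> A) (at z)"
      using A z by (simp add: eventually_at_in_open')
    with ev[OF z] have "eventually (\<lambda>x. g x \<noteq> 0 \<and> x \<in> A) (at z)"
      by eventually_elim auto
    then obtain d where d: "d > 0" "\<And>x. x \<noteq> z \<Longrightarrow> dist x z < d \<Longrightarrow> g x \<noteq> 0 \<and> x \<in> A"
      unfolding eventually_at by auto
    have ball: "ball z d \<subseteq> A"
      using d(2) z by (metis dist_commute mem_ball subsetI)
    have quot: "(\<lambda>x. f x / g x) holomorphic_on (ball z d - {z})"
      using d ball
      by (intro holomorphic_on_divide holomorphic_on_subset[OF hol(1)] holomorphic_on_subset[OF hol(2)])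
         (auto simp: dist_commute)
    have h1: "?h holomorphic_on (ball z d - {z})"
      using d by (intro holomorphic_transform[OF quot]) (auto simp: dist_commute)
    have "?h holomorphic_on ball z d"
    proof (cases "g z = 0")
      case True
      have lim: "((\<lambda>x. F x / (x - z)) \<longlongrightarrow> deriv F z) (at z)" if "F holomorphic_on A" "F z = 0" for F
        using holomorphic_derivI[OF that(1) A z] that(2) by (simp add: has_field_derivative_iff)
      have "((\<lambda>x. (f x / (x - z)) / (g x / (x - z))) \<longlongrightarrow> deriv f z / deriv g z) (at z)"
        using zero[OF z True] True by (intro tendsto_divide lim hol) auto
      moreover have "eventually (\<lambda>x. (f x / (x - z)) / (g x / (x - z)) = ?h x) (at z)"
        unfolding eventually_at using d by (intro exI[of _ d]) auto
      ultimately have cont_z: "isCont ?h z"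
        using True by (simp cong: tendsto_cong add: isCont_def)
      have "open (ball z d - {z})"
        by (intro open_delete open_ball)
      then have "isCont ?h y" if "y \<in> ball z d - {z}" for y
        using holomorphic_on_imp_continuous_on[OF h1] that continuous_on_eq_continuous_at by blast
      with cont_z have "continuous_on (ball z d) ?h"
        by (intro continuous_at_imp_continuous_on) blast
      then show ?thesis
        using h1 by (intro no_isolated_singularity[of "ball z d" _ "{z}"]) auto
    next
      case False
      then have "\<And>x. x \<in> ball z d \<Longrightarrow> g x \<noteq> 0"
        using d by (metis dist_commute mem_ball)
      then have "(\<lambda>x. f x / g x) holomorphic_on ball z d"
        using ball by (intro holomorphic_on_divide holomorphic_on_subset[OF hol(1)]
            holomorphic_on_subset[OF hol(2)]) auto
      then show ?thesis
        by (rule holomorphic_transform) (use \<open>\<And>x. x \<in> ball z d \<Longrightarrow> g x \<noteq> 0\<close> in auto)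
    qed
    then show ?thesis
      using d(1) analytic_at_ball by blast
  qed
  then show "?h holomorphic_on A"
    by (meson analytic_imp_holomorphic analytic_on_analytic_at)
qed

text \<open>A Liouville argument: the quotient descends to the torus $\mathbb{C}^*/p^{\mathbb{Z}}$,
  so it is bounded, and composing it with the exponential yields a bounded entire function.\<close>

lemma quasi_periodic_proportional:
  fixes f g m :: "complex \<Rightarrow> complex"
  assumes p: "p \<noteq> 0" "norm p < 1"
    and hol: "f holomorphic_on - {0}" "g holomorphic_on - {0}"
    and f: "\<And>x. x \<noteq> 0 \<Longrightarrow> f (p * x) = m x * f x"
    and g: "\<And>x. x \<noteq> 0 \<Longrightarrow> g (p * x) = m x * g x"
    and m: "\<And>x. x \<noteq> 0 \<Longrightarrow> m x \<noteq> 0"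
    and zero: "\<And>x. x \<noteq> 0 \<Longrightarrow> g x = 0 \<Longrightarrow> f x = 0 \<and> deriv g x \<noteq> 0"
  obtains C where "\<And>x. x \<noteq> 0 \<Longrightarrow> f x = C * g x"
proof -
  define h where "h = (\<lambda>x. if g x = 0 then deriv f x / deriv g x else f x / g x)"
  have h: "h holomorphic_on - {0}"
    unfolding h_def by (rule holomorphic_quotient_simple_zeros) (use hol zero in auto)
  have ev: "eventually (\<lambda>x. g x \<noteq> 0) (at z)" if "z \<noteq> 0" for z
    using holomorphic_quotient_simple_zeros(2)[OF hol _ zero, of z] that by auto
  have cont: "isCont h z" if "z \<noteq> 0" for z
    using holomorphic_on_imp_continuous_on[OF h] continuous_on_eq_continuous_at[of "- {0}" h] that
    by auto
  \<comment> \<open>Away from the zeros of \<open>g\<close> the multiplier \<open>m\<close> cancels;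
    at the zeros both sides are limits of nearby values.\<close>
  have per: "h (p * x) = h x" if x: "x \<noteq> 0" for x
  proof -
    have "eventually (\<lambda>y. y \<noteq> 0) (at x)"
      using x by (intro tendsto_imp_eventually_ne[OF tendsto_ident_at])
    with ev[OF x] have "eventually (\<lambda>y. h (p * y) = h y) (at x)"
    proof eventually_elim
      case (elim y)
      then show ?case using f[of y] g[of y] m[of y] by (simp add: h_def)
    qed
    moreover have "((\<lambda>y. h (p * y)) \<longlongrightarrow> h (p * x)) (at x)"
      by (intro isCont_tendsto_compose[OF cont] tendsto_intros) (use x p in auto)
    ultimately have "(h \<longlongrightarrow> h (p * x)) (at x)"
      by (simp cong: tendsto_cong)
    then show ?thesis
      using cont[OF x] unfolding isCont_def by (intro tendsto_unique[of "at x" h]) auto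
  qed
  have per_int: "h (p powi n * x) = h x" if x: "x \<noteq> 0" for n x
  proof (induction n rule: int_induct[where k = 0])
    case (step1 i)
    then show ?case
      using per[of "p powi i * x"] x p(1) by (simp add: power_int_add mult_ac)
  next
    case (step2 i)
    have "p * (p powi (i - 1) * x) = p powi i * x"
      using p(1) by (simp add: power_int_diff)
    then show ?case
      using per[of "p powi (i - 1) * x"] step2.IH x p(1)
    by (metis mult_eq_0_iff power_int_eq_0_iff)
  qed (use x in auto)
  define K where "K = {x :: complex. norm p \<le> norm x \<and> norm x \<le> 1}"
  have "compact K"
  proof -
    have "K = cball 0 1 \<inter> {x. norm p \<le> norm x}"
      unfolding K_def by auto
    moreover have "closed {x :: complex. norm p \<le> norm x}"
      by (intro closed_Collect_le continuous_intros)
    ultimately show ?thesis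
      by (simp add: compact_Int_closed)
  qed
  moreover have "continuous_on K h"
    using p(1) by (intro continuous_at_imp_continuous_on ballI cont) (auto simp: K_def)
  ultimately have "bounded (h ` K)"
    by (intro compact_imp_bounded compact_continuous_image)
  then obtain M where M: "\<And>x. x \<in> K \<Longrightarrow> norm (h x) \<le> M"
    unfolding bounded_iff by auto
  \<comment> \<open>The annulus \<open>K\<close> is a fundamental domain: \<open>t\<close> is the
    logarithm of the norm of x to base \<open>norm p\<close>, and dividing x by p to the power
    \<open>n\<close>, the floor of \<open>t\<close>, moves it into \<open>K\<close>.\<close>
  have bound: "norm (h x) \<le> M" if x: "x \<noteq> 0" for x
  proof -
    define t where "t = ln (norm x) / ln (norm p)"
    define n where "n = \<lfloor>t\<rfloor>"
    have lp: "ln (norm p) < 0"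
      using p by simp
    have "norm (p powi (- n) * x) = norm p powr (- of_int n) * norm x"
      using p(1) powr_real_of_int'[of "norm p" "- n"] by (simp add: norm_mult norm_power_int)
    also have "norm x = norm p powr t"
      using x p lp by (simp add: t_def powr_def)
    finally have eq: "norm (p powi (- n) * x) = norm p powr (t - of_int n)"
      by (simp add: powr_add[symmetric])
    have "0 \<le> t - of_int n" "t - of_int n \<le> 1"
      unfolding n_def by linarith+
    then have "norm p powr 1 \<le> norm p powr (t - of_int n)" "norm p powr (t - of_int n) \<le> norm p powr 0"
      using p by (intro powr_mono'; simp)+
    then have "p powi (- n) * x \<in> K"
      using eq p(1) by (simp add: K_def)
    then show ?thesis
      using M[of "p powi (- n) * x"] per_int[OF x] by metis
  qed
  have "(h \<circ> exp) holomorphic_on UNIV"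
    by (rule holomorphic_on_compose_gen[OF _ h]) (auto intro: holomorphic_intros)
  moreover have "bounded (range (h \<circ> exp))"
    unfolding bounded_iff using bound by (intro exI[of _ M]) auto
  ultimately have "(h \<circ> exp) constant_on UNIV"
    by (rule Liouville_theorem)
  then obtain C where C: "\<And>w. (h \<circ> exp) w = C"
    unfolding constant_on_def by blast
  have "f x = C * g x" if "x \<noteq> 0" for x
  proof -
    have "h x = C"
      using C[of "Ln x"] that by simp
    then show ?thesis
      using zero[OF that] by (cases "g x = 0") (auto simp: h_def field_simps)
  qed
  then show ?thesis
    by (rule that)
qed

section \<open>Addition formulas for theta functions\<close>

lemma theta_powi_eq_0_iff:
  assumes "norm p < 1" "p \<noteq> 0" "x \<noteq> 0"
  shows "theta (p powi n * x) p = 0 \<longleftrightarrow> theta x p = 0"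
proof -
  have "p powi n * x = p powi k \<longleftrightarrow> x = p powi (k - n)" for k
    using assms by (auto simp: power_int_diff field_simps)
  then have "(\<exists>k. p powi n * x = p powi k) \<longleftrightarrow> (\<exists>k. x = p powi k)"
    by (metis add_diff_cancel_right')
  then show ?thesis
    using assms by (simp add: theta_eq_0_iff)
qed

lemma theta_scale_deriv:
  assumes "norm p < 1" "p \<noteq> 0" "x \<noteq> 0" "u \<noteq> 0"
  shows "((\<lambda>x. theta (x * u) p) has_field_derivative deriv (\<lambda>x. theta x p) (x * u) * u) (at x)"
proof -
  have "(\<lambda>x. theta x p) holomorphic_on - {0}"
    using assms by (intro holomorphic_intros) auto
  from holomorphic_derivI[OF this, of "x * u"] show ?thesis
    by (intro DERIV_chain2[where g = "\<lambda>x. x * u"])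
       (use assms in \<open>auto intro!: derivative_eq_intros\<close>)
qed

text \<open>As functions of x both sides have the multiplier 1/x^2, and the right side vanishes only
  at u and 1/u up to powers of p, where the left side vanishes too. The assumption on u^2 keeps
  these two zero classes apart, so that the zeros are simple; the other two make the right-hand
  product nonzero at x = y, where the constant is read off.\<close>

theorem theta_three_term:
  assumes p: "norm p < 1" "p \<noteq> 0" and nz: "x \<noteq> 0" "y \<noteq> 0" "u \<noteq> 0" "v \<noteq> 0"
    and gen: "theta (u\<^sup>2) p \<noteq> 0" "theta (y * u) p \<noteq> 0" "theta (y / u) p \<noteq> 0"
  shows "theta (x * y) p * theta (x / y) p * theta (u * v) p * theta (u / v) p
      - theta (x * v) p * theta (x / v) p * theta (u * y) p * theta (u / y) p
    = u / y * theta (y * v) p * theta (y / v) p * theta (x * u) p * theta (x / u) p"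
proof -
  define f where "f = (\<lambda>x. theta (x * y) p * theta (x / y) p * theta (u * v) p * theta (u / v) p
      - theta (x * v) p * theta (x / v) p * theta (u * y) p * theta (u / y) p)"
  define g where "g = (\<lambda>x. theta (x * u) p * theta (x * (1 / u)) p)"
  have shift: "theta (p * x * w) p = - theta (x * w) p / (x * w)"
       "theta (p * x / w) p = - theta (x / w) p * w / x" if "x \<noteq> 0" "w \<noteq> 0" for x w
    using theta_mult_nome[OF p, of "x * w"] theta_mult_nome[OF p, of "x / w"] that
    by (simp_all add: mult.assoc)
  have fp: "f (p * x) = 1 / x\<^sup>2 * f x" if "x \<noteq> 0" for x
    using that nz unfolding f_def by (simp add: shift) (simp add: field_simps power2_eq_square)
  have gp: "g (p * x) = 1 / x\<^sup>2 * g x" if "x \<noteq> 0" for x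
    using that nz unfolding g_def by (simp add: shift) (simp add: field_simps power2_eq_square)
  have inv: "theta (w / u) p * theta (1 / (u * w)) p = theta (u * w) p * theta (u / w) p / u\<^sup>2"
    if "w \<noteq> 0" for w
  proof -
    have "theta (w / u) p = - theta (u / w) p * w / u" "theta (1 / (u * w)) p = - theta (u * w) p / (u * w)"
      using theta_inverse[OF p, of "u * w"] theta_inverse[OF p, of "u / w"] that nz by simp_all
    then show ?thesis
      using that nz by (simp add: power2_eq_square)
  qed
  have "f (1 / u) = (theta (y / u) p * theta (1 / (u * y)) p) * (theta (u * v) p * theta (u / v) p)
      - (theta (v / u) p * theta (1 / (u * v)) p) * (theta (u * y) p * theta (u / y) p)"
    unfolding f_def by (simp add: mult_ac)
  then have f_inv: "f (1 / u) = 0"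
    using inv nz by (simp add: mult_ac)
  have f_u: "f u = 0"
    unfolding f_def by (simp add: mult_ac)
  have zero: "f x = 0 \<and> deriv g x \<noteq> 0" if x: "x \<noteq> 0" and gx: "g x = 0" for x
  proof -
    let ?D = "deriv (\<lambda>x. theta x p)"
    have "(g has_field_derivative ?D (x * u) * u * theta (x * (1 / u)) p
        + ?D (x * (1 / u)) * (1 / u) * theta (x * u) p) (at x)"
      unfolding g_def using p x nz by (intro DERIV_mult theta_scale_deriv) auto
    then have dg: "deriv g x = ?D (x * u) * u * theta (x / u) p
        + ?D (x / u) / u * theta (x * u) p"
      using DERIV_imp_deriv by fastforce
    consider "theta (x * u) p = 0" | "theta (x / u) p = 0"
      using gx unfolding g_def by auto
    then show ?thesis
    proof cases
      case 1
      then obtain n where "x * u = p powi n"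
        using theta_eq_0_iff[OF p, of "x * u"] x nz by auto
      then have n: "x = p powi n * (1 / u)"
        using nz by (simp add: field_simps)
      have "f x = 0"
        unfolding n
        by (rule quasi_periodic_zero[where m = "\<lambda>x. 1 / x\<^sup>2"]) (use p nz fp f_inv in auto)
      moreover have "theta (1 / u\<^sup>2) p \<noteq> 0"
        using theta_inverse[OF p, of "u\<^sup>2"] nz gen by simp
      then have "theta (x / u) p \<noteq> 0"
        using theta_powi_eq_0_iff[OF p, of "1 / u\<^sup>2" n] nz
        by (simp add: n power2_eq_square)
      moreover have "?D (x * u) \<noteq> 0"
        using theta_deriv_zero_nonzero[OF p _ 1] x nz by auto
      ultimately show ?thesis
        using dg 1 nz by simp
    next
      case 2
      then obtain n where "x / u = p powi n"
        using theta_eq_0_iff[OF p, of "x / u"] x nz by auto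
      then have n: "x = p powi n * u"
        using nz by (simp add: field_simps)
      have "f x = 0"
        unfolding n
        by (rule quasi_periodic_zero[where m = "\<lambda>x. 1 / x\<^sup>2"]) (use p nz fp f_u in auto)
      moreover have "theta (x * u) p \<noteq> 0"
        using theta_powi_eq_0_iff[OF p, of "u\<^sup>2" n] nz gen
        by (simp add: n power2_eq_square mult.assoc)
      moreover have "?D (x / u) \<noteq> 0"
        using theta_deriv_zero_nonzero[OF p _ 2] x nz by auto
      ultimately show ?thesis
        using dg 2 nz by simp
    qed
  qed
  have hol: "f holomorphic_on - {0}" "g holomorphic_on - {0}"
    unfolding f_def g_def using nz p by (intro holomorphic_intros; auto)+
  have m: "1 / x\<^sup>2 \<noteq> 0" if "x \<noteq> 0" for x :: complex
    using that by simp
  obtain C where C: "\<And>x. x \<noteq> 0 \<Longrightarrow> f x = C * g x"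
    by (rule quasi_periodic_proportional[OF p(2,1) hol fp gp m zero]) blast+
  \<comment> \<open>At x = y the first product of \<open>f\<close> contains
    \<open>theta 1 p\<close>, which is 0, so one product survives and determines
    \<open>C\<close>.\<close>
  have "theta (u / y) p = - (u / y) * theta (y / u) p"
    using theta_inverse[OF p, of "y / u"] nz by simp
  then have "f y = u / y * theta (y * v) p * theta (y / v) p * g y"
    unfolding f_def g_def using nz p by (simp add: mult_ac)
  moreover have "g y \<noteq> 0"
    using gen by (simp add: g_def)
  ultimately have "C = u / y * theta (y * v) p * theta (y / v) p"
    using C[OF nz(2)] by (metis mult_cancel_right)
  then show ?thesis
    using C[OF nz(1)] by (simp add: f_def g_def)
qed

text \<open>Cubing x and the nome gives the same multiplier -1/x^3 as the cube of theta, so both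
  terms on the left can be compared with a product of three thetas vanishing at 1, y and 1/y. The
  assumptions on y keep these three zero classes distinct.\<close>

theorem theta_cubic:
  assumes p: "norm p < 1" "p \<noteq> 0" and nz: "x \<noteq> 0" "y \<noteq> 0"
    and gen: "theta y p \<noteq> 0" "theta (y\<^sup>2) p \<noteq> 0"
  shows "theta (x ^ 3) (p ^ 3) * theta y p ^ 3 - theta (y ^ 3) (p ^ 3) * theta x p ^ 3
    = - 3 * y * (qpoch_inf (p ^ 3) (p ^ 3) / qpoch_inf p p)\<^sup>2
      * theta y p * theta x p * theta (x * y) p * theta (x / y) p"
proof -
  define f where "f = (\<lambda>x. theta (x ^ 3) (p ^ 3) * theta y p ^ 3
      - theta (y ^ 3) (p ^ 3) * theta x p ^ 3)"
  define g where "g = (\<lambda>x. theta (x * 1) p * (theta (x * y) p * theta (x * (1 / y)) p))"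
  have p3: "norm (p ^ 3) < 1" "p ^ 3 \<noteq> 0"
    using p by (auto simp: norm_power power_less_one_iff)
  have shift: "theta (p * x * w) p = - theta (x * w) p / (x * w)"
       "theta (p * x / w) p = - theta (x / w) p * w / x" if "x \<noteq> 0" "w \<noteq> 0" for x w
    using theta_mult_nome[OF p, of "x * w"] theta_mult_nome[OF p, of "x / w"] that
    by (simp_all add: mult.assoc)
  have fp: "f (p * x) = - 1 / x ^ 3 * f x" if "x \<noteq> 0" for x
    using that unfolding f_def
    by (simp add: power_mult_distrib theta_mult_nome[OF p] theta_mult_nome[OF p3] power_divide)
       (simp add: field_simps)
  have gp: "g (p * x) = - 1 / x ^ 3 * g x" if "x \<noteq> 0" for x
    using that nz theta_mult_nome[OF p that] unfolding g_def
    by (simp add: shift) (simp add: field_simps power3_eq_cube)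
  have inv: "theta (1 / y) p = - theta y p / y" "theta ((1 / y) ^ 3) (p ^ 3) = - theta (y ^ 3) (p ^ 3) / y ^ 3"
    using theta_inverse[OF p nz(2)] theta_inverse[OF p3, of "y ^ 3"] nz by (simp_all add: power_divide)
  have f_inv: "f (1 / y) = 0"
    unfolding f_def inv using nz by (simp add: field_simps)
  have f_y: "f y = 0"
    unfolding f_def by simp
  have f_1: "f 1 = 0"
    unfolding f_def using p p3 by simp
  have iy: "theta (1 / y) p \<noteq> 0" "theta (1 / y\<^sup>2) p \<noteq> 0"
    using theta_inverse[OF p nz(2)] theta_inverse[OF p, of "y\<^sup>2"] nz gen by simp_all
  let ?D = "deriv (\<lambda>x. theta x p)"
  have der: "(g has_field_derivative ?D (x * 1) * 1 * (theta (x * y) p * theta (x * (1 / y)) p)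
        + (?D (x * y) * y * theta (x * (1 / y)) p
        + ?D (x * (1 / y)) * (1 / y) * theta (x * y) p) * theta (x * 1) p) (at x)"
    if "x \<noteq> 0" for x
    unfolding g_def using p that nz by (intro DERIV_mult theta_scale_deriv) auto
  have zero: "f x = 0 \<and> deriv g x \<noteq> 0" if x: "x \<noteq> 0" and gx: "g x = 0" for x
  proof -
    have dg: "deriv g x = ?D x * theta (x * y) p * theta (x / y) p
        + (?D (x * y) * y * theta (x / y) p + ?D (x / y) / y * theta (x * y) p) * theta x p"
      using DERIV_imp_deriv[OF der[OF x]] by (simp add: mult_ac)
    have fz: "f (p powi n * z) = 0" if "z \<noteq> 0" "f z = 0" for n z
      by (rule quasi_periodic_zero[where m = "\<lambda>x. - 1 / x ^ 3"]) (use p that fp in auto)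
    consider "theta x p = 0" | "theta (x * y) p = 0" | "theta (x / y) p = 0"
      using gx unfolding g_def by auto
    then show ?thesis
    proof cases
      case 1
      then obtain n where n: "x = p powi n"
        using theta_eq_0_iff[OF p x] by auto
      have "f x = 0"
        using fz[of 1 n] f_1 n by simp
      moreover have "theta (x * y) p \<noteq> 0" "theta (x / y) p \<noteq> 0"
        using theta_powi_eq_0_iff[OF p, of y n] theta_powi_eq_0_iff[OF p, of "1 / y" n] nz gen iy
        by (simp_all add: n)
      moreover have "?D x \<noteq> 0"
        using theta_deriv_zero_nonzero[OF p x 1] .
      ultimately show ?thesis
        using dg 1 nz by simp
    next
      case 2
      then obtain n where "x * y = p powi n"
        using theta_eq_0_iff[OF p, of "x * y"] x nz by auto
      then have n: "x = p powi n * (1 / y)"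
        using nz by (simp add: field_simps)
      have "f x = 0"
        unfolding n by (rule fz) (use f_inv nz in auto)
      moreover have "theta x p \<noteq> 0" "theta (x / y) p \<noteq> 0"
        using theta_powi_eq_0_iff[OF p, of "1 / y" n] theta_powi_eq_0_iff[OF p, of "1 / y\<^sup>2" n] nz iy
        by (simp_all add: n power2_eq_square)
      moreover have "?D (x * y) \<noteq> 0"
        using theta_deriv_zero_nonzero[OF p _ 2] x nz by auto
      ultimately show ?thesis
        using dg 2 nz by simp
    next
      case 3
      then obtain n where "x / y = p powi n"
        using theta_eq_0_iff[OF p, of "x / y"] x nz by auto
      then have n: "x = p powi n * y"
        using nz by (simp add: field_simps)
      have "f x = 0"
        unfolding n by (rule fz) (use f_y nz in auto)
      moreover have "theta x p \<noteq> 0" "theta (x * y) p \<noteq> 0"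
        using theta_powi_eq_0_iff[OF p, of y n] theta_powi_eq_0_iff[OF p, of "y\<^sup>2" n] nz gen
        by (simp_all add: n power2_eq_square mult.assoc)
      moreover have "?D (x / y) \<noteq> 0"
        using theta_deriv_zero_nonzero[OF p _ 3] x nz by auto
      ultimately show ?thesis
        using dg 3 nz by simp
    qed
  qed
  have hol: "f holomorphic_on - {0}" "g holomorphic_on - {0}"
    unfolding f_def g_def using nz p p3 by (intro holomorphic_intros; auto)+
  have m: "- 1 / x ^ 3 \<noteq> 0" if "x \<noteq> 0" for x :: complex
    using that by simp
  obtain C where C: "\<And>x. x \<noteq> 0 \<Longrightarrow> f x = C * g x"
    by (rule quasi_periodic_proportional[OF p(2,1) hol fp gp m zero]) blast+
  let ?P = "qpoch_inf p p" and ?P3 = "qpoch_inf (p ^ 3) (p ^ 3)"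
  \<comment> \<open>The constant comes from derivatives at the common zero 1. The cube of theta has
    a triple zero there and contributes nothing; the factor 3 is the derivative of x^3.\<close>
  have "(f has_field_derivative - 3 * ?P3\<^sup>2 * theta y p ^ 3) (at 1)"
  proof -
    have 1: "((\<lambda>x. theta (x ^ 3) (p ^ 3)) has_field_derivative - ?P3\<^sup>2 * 3) (at 1)"
    proof (rule DERIV_chain2[where g = "\<lambda>x::complex. x ^ 3"])
      show "((\<lambda>x. theta x (p ^ 3)) has_field_derivative - ?P3\<^sup>2) (at (1 ^ 3))"
        using theta_deriv_1[OF p3] by simp
    qed (auto intro!: derivative_eq_intros)
    have 2: "((\<lambda>x. theta x p ^ 3) has_field_derivative 0) (at 1)"
      using DERIV_power[OF theta_deriv_1[OF p], of 3] p by simp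
    show ?thesis
      unfolding f_def by (rule derivative_eq_intros 1 2 refl | simp)+
  qed
  moreover have "(g has_field_derivative - ?P\<^sup>2 * theta y p * theta (1 / y) p) (at 1)"
    using der[of 1] DERIV_imp_deriv[OF theta_deriv_1[OF p]] p by (simp add: mult.assoc)
  then have "((\<lambda>x. C * g x) has_field_derivative C * (- ?P\<^sup>2 * theta y p * theta (1 / y) p)) (at 1)"
    by (rule DERIV_cmult)
  then have "(f has_field_derivative C * (- ?P\<^sup>2 * theta y p * theta (1 / y) p)) (at 1)"
    by (rule has_field_derivative_transform_within_open[where S = "- {0}"]) (use C in auto)
  ultimately have "- 3 * ?P3\<^sup>2 * theta y p ^ 3 = C * (- ?P\<^sup>2 * theta y p * theta (1 / y) p)"
    by (rule DERIV_unique)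
  then have "- 3 * ?P3\<^sup>2 * theta y p ^ 3 = C * (?P\<^sup>2 * theta y p ^ 2 / y)"
    unfolding inv by (simp add: power2_eq_square)
  then have "(C * ?P\<^sup>2 + 3 * y * ?P3\<^sup>2 * theta y p) * theta y p ^ 2 = 0"
    using nz by (simp add: divide_simps) algebra
  then have "C * ?P\<^sup>2 = - 3 * y * ?P3\<^sup>2 * theta y p"
    using gen by (simp add: eq_neg_iff_add_eq_0)
  then have "C = - 3 * y * (?P3 / ?P)\<^sup>2 * theta y p"
    using qpoch_inf_nome_nonzero[OF p(1)] by (simp add: power_divide) (simp add: field_simps)
  then show ?thesis
    using C[OF nz(1)] by (simp add: f_def g_def mult_ac)
qed

section \<open>Modular equations of degree two and three\<close>

lemma rr_T_eq:
  "rr_T q = qpoch_inf q (q ^ 5) * qpoch_inf (q ^ 4) (q ^ 5)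
     / (qpoch_inf (q ^ 2) (q ^ 5) * qpoch_inf (q ^ 3) (q ^ 5))"
  by (simp add: rr_T_def rr_G_def rr_H_def)

lemma rr_T_0 [simp]: "rr_T 0 = 1"
  by (simp add: rr_T_eq)

lemma qpoch_inf_power_nonzero:
  assumes "norm q < 1" "m > 0" "n > 0"
  shows "qpoch_inf (q ^ m) (q ^ n) \<noteq> 0"
proof -
  have "norm (q ^ n) < 1"
    using assms by (simp add: norm_power power_less_one_iff)
  moreover have "norm (q ^ m * (q ^ n) ^ k) < 1" for k
    using assms by (simp add: norm_power power_less_one_iff flip: power_mult power_add)
  then have "q ^ m * (q ^ n) ^ k \<noteq> 1" for k
    by (metis less_irrefl norm_one)
  ultimately show ?thesis
    by (simp add: qpoch_inf_eq_0_iff)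
qed

lemma rr_T_nonzero: "norm q < 1 \<Longrightarrow> rr_T q \<noteq> 0"
  using qpoch_inf_power_nonzero[of q 1 5] qpoch_inf_power_nonzero[of q 4 5]
    qpoch_inf_power_nonzero[of q 2 5] qpoch_inf_power_nonzero[of q 3 5]
  by (simp add: rr_T_eq)

lemma holomorphic_rr_T: "rr_T holomorphic_on ball 0 1"
proof -
  have "norm (q ^ 5) < 1" if "q \<in> ball 0 1" for q :: complex
    using that by (simp add: norm_power power_less_one_iff)
  then have "(\<lambda>q. qpoch_inf q (q ^ 5) * qpoch_inf (q ^ 4) (q ^ 5)
     / (qpoch_inf (q ^ 2) (q ^ 5) * qpoch_inf (q ^ 3) (q ^ 5))) holomorphic_on ball 0 1"
    by (intro holomorphic_intros) (use qpoch_inf_power_nonzero in auto)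
  then show ?thesis
    by (simp add: rr_T_eq[abs_def])
qed

lemma rr_T_theta:
  assumes "q \<noteq> 0"
  shows "rr_T q = theta q (q ^ 5) / theta (q ^ 2) (q ^ 5)"
proof -
  have "q ^ 5 / q = q ^ 4" "q ^ 5 / q ^ 2 = q ^ 3"
    using assms by (simp_all add: eval_nat_numeral)
  then show ?thesis
    by (simp add: rr_T_eq theta_def)
qed

text \<open>Recording only exponents turns theta identities into bookkeeping with indices modulo n.
  The index is an integer because the three-term relation involves differences.\<close>

definition theta_pow :: "complex \<Rightarrow> nat \<Rightarrow> int \<Rightarrow> complex" where
  "theta_pow q n i = theta (q powi i) (q ^ n)"

context
  fixes q :: complex and n :: nat
  assumes q: "norm q < 1" "q \<noteq> 0" and n: "n > 0"
begin

lemma norm_power_less_1: "norm (q ^ n) < 1"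
  using q n by (simp add: norm_power power_less_one_iff)

lemma powi_eq_iff: "q powi i = q powi j \<longleftrightarrow> i = j"
proof
  assume "q powi i = q powi j"
  then have "norm q powi i = norm q powi j"
    by (metis norm_power_int)
  then show "i = j"
    using power_int_strict_decreasing[of i j "norm q"] power_int_strict_decreasing[of j i "norm q"] q
    by (cases i j rule: linorder_cases) auto
qed simp

lemma theta_pow_reflect: "theta_pow q n (int n - i) = theta_pow q n i"
  using theta_reflect[of "q ^ n" "q powi i"] q by (simp add: theta_pow_def power_int_diff)

lemma theta_pow_minus: "theta_pow q n (- i) = - theta_pow q n i / q powi i"
  using theta_inverse[OF norm_power_less_1, of "q powi i"] q
  by (simp add: theta_pow_def power_int_minus divide_inverse)

lemma theta_pow_eq_0_iff: "theta_pow q n i = 0 \<longleftrightarrow> int n dvd i"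
proof -
  have "(\<exists>k. q powi i = (q ^ n) powi k) \<longleftrightarrow> (\<exists>k. q powi i = q powi (int n * k))"
    by (simp add: power_int_mult)
  also have "\<dots> \<longleftrightarrow> int n dvd i"
    by (simp add: powi_eq_iff dvd_def)
  finally show ?thesis
    unfolding theta_pow_def using theta_eq_0_iff[OF norm_power_less_1, of "q powi i"] q by simp
qed

lemma theta_pow_three_term:
  assumes "\<not> int n dvd 2 * u" "\<not> int n dvd y + u" "\<not> int n dvd y - u"
  shows "theta_pow q n (x + y) * theta_pow q n (x - y) * theta_pow q n (u + v) * theta_pow q n (u - v)
      - theta_pow q n (x + v) * theta_pow q n (x - v) * theta_pow q n (u + y) * theta_pow q n (u - y)
    = q powi (u - y) * theta_pow q n (y + v) * theta_pow q n (y - v)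
      * theta_pow q n (x + u) * theta_pow q n (x - u)"
proof -
  have e: "q powi i * q powi j = q powi (i + j)" "q powi i / q powi j = q powi (i - j)" for i j
    using q by (simp_all add: power_int_add power_int_diff)
  have "(q powi u)\<^sup>2 = q powi (2 * u)"
    by (simp add: power_int_mult mult.commute[of 2])
  then have "theta ((q powi u)\<^sup>2) (q ^ n) \<noteq> 0" "theta (q powi y * q powi u) (q ^ n) \<noteq> 0"
      "theta (q powi y / q powi u) (q ^ n) \<noteq> 0"
    using assms by (simp_all add: e theta_pow_eq_0_iff flip: theta_pow_def)
  from theta_three_term[OF norm_power_less_1 _ _ _ _ _ this, of "q powi x" "q powi v"] show ?thesis
    using q by (simp add: e theta_pow_def)
qed

lemma theta_pow_split:
  assumes "m > 0"
  shows "theta_pow q n i = (\<Prod>j<m. theta_pow q (n * m) (i + int n * int j))"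
  using theta_split[OF norm_power_less_1 assms, of "q powi i"] q
  by (simp add: theta_pow_def power_int_add power_int_mult power_mult)

end

lemma rr_T_theta_pow:
  assumes "q \<noteq> 0"
  shows "rr_T (q ^ k) = theta_pow q (5 * k) (int k) / theta_pow q (5 * k) (2 * int k)"
  using rr_T_theta[of "q ^ k"] assms
  by (simp add: theta_pow_def power_int_mult mult.commute flip: power_mult)

text \<open>In terms of thetas of nome q^10 the two values are t1 t4 / (t2 t3) and t2 / t4. Two
  three-term relations with v = 0 bring in the extra value t5 linearly, and eliminating it leaves
  the modular equation.\<close>

theorem rr_T_modular_2:
  assumes "norm q < 1"
  shows "rr_T (q ^ 2) - rr_T q ^ 2 = q * rr_T q * rr_T (q ^ 2) ^ 2 * (rr_T (q ^ 2) + rr_T q ^ 2)"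
proof (cases "q = 0")
  case False
  note q = assms False
  define t where "t = theta_pow q 10"
  have nz: "t 1 \<noteq> 0" "t 2 \<noteq> 0" "t 3 \<noteq> 0" "t 4 \<noteq> 0"
    unfolding t_def using theta_pow_eq_0_iff[OF q, of 10] by simp_all
  have refl: "t 6 = t 4" "t 7 = t 3"
    unfolding t_def using theta_pow_reflect[OF q, of 10 4] theta_pow_reflect[OF q, of 10 3] by simp_all
  have T1: "rr_T q = t 1 * t 4 / (t 2 * t 3)"
    using rr_T_theta_pow[of q 1] theta_pow_split[OF q, of 5 2] q refl
    by (simp add: t_def numeral_2_eq_2)
  have T2: "rr_T (q ^ 2) = t 2 / t 4"
    using rr_T_theta_pow[of q 2] q by (simp add: t_def)
  have "t 4 * t 2 * t 3 ^ 2 - t 4 ^ 2 * t 5 * t 1 = q * t 2 ^ 2 * t 3 * t 1"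
    using theta_pow_three_term[OF q, of 10 3 2 4 0]
    by (simp add: refl power2_eq_square mult_ac flip: t_def)
  moreover have "t 5 * t 3 * t 2 ^ 2 - t 4 ^ 2 * t 3 * t 1 = q * t 1 ^ 2 * t 4 * t 2"
    using theta_pow_three_term[OF q, of 10 2 1 4 0]
    by (simp add: refl power2_eq_square mult_ac flip: t_def)
  ultimately have "(t 2 ^ 3 * t 3 ^ 2 - t 1 ^ 2 * t 4 ^ 3) * (t 3 * t 4)
      = q * t 1 * t 2 * (t 2 ^ 3 * t 3 ^ 2 + t 1 ^ 2 * t 4 ^ 3)"
    by algebra
  then have "(t 2 ^ 3 * t 3 ^ 2 - t 1 ^ 2 * t 4 ^ 3) / (t 2 ^ 2 * t 3 ^ 2 * t 4)
      = q * t 1 * t 2 / (t 3 * t 4)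
        * ((t 2 ^ 3 * t 3 ^ 2 + t 1 ^ 2 * t 4 ^ 3) / (t 2 ^ 2 * t 3 ^ 2 * t 4))"
    using nz by (simp add: divide_simps mult_ac)
  moreover have "rr_T (q ^ 2) - rr_T q ^ 2
      = (t 2 ^ 3 * t 3 ^ 2 - t 1 ^ 2 * t 4 ^ 3) / (t 2 ^ 2 * t 3 ^ 2 * t 4)"
    unfolding T1 T2 using nz by (simp add: field_simps power2_eq_square power3_eq_cube)
  moreover have "rr_T (q ^ 2) + rr_T q ^ 2
      = (t 2 ^ 3 * t 3 ^ 2 + t 1 ^ 2 * t 4 ^ 3) / (t 2 ^ 2 * t 3 ^ 2 * t 4)"
    unfolding T1 T2 using nz by (simp add: field_simps power2_eq_square power3_eq_cube)
  moreover have "q * rr_T q * rr_T (q ^ 2) ^ 2 = q * t 1 * t 2 / (t 3 * t 4)"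
    unfolding T1 T2 using nz by (simp add: field_simps power2_eq_square)
  ultimately show ?thesis
    by simp
qed simp

text \<open>The two factors on the left are evaluated separately as theta products: the difference
  by \<open>theta_cubic\<close> with nome q^5 at x = q, y = q^2, the other factor by a three-term
  relation with nome q^15. The square of t5 cancels in their product.\<close>

theorem rr_T_modular_3:
  assumes "norm q < 1"
  shows "(rr_T (q ^ 3) - rr_T q ^ 3) * (1 + q ^ 2 * rr_T q * rr_T (q ^ 3) ^ 3)
    = 3 * q * rr_T q ^ 2 * rr_T (q ^ 3) ^ 2"
proof (cases "q = 0")
  case False
  note q = assms False
  define t where "t = theta_pow q 15"
  define A where "A = theta_pow q 5 1"
  define B where "B = theta_pow q 5 2"
  have nz: "t 2 \<noteq> 0" "t 3 \<noteq> 0" "t 5 \<noteq> 0" "t 6 \<noteq> 0" "t 7 \<noteq> 0" "B \<noteq> 0"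
    and A0: "A \<noteq> 0"
    unfolding t_def A_def B_def using theta_pow_eq_0_iff[OF q, of 15] theta_pow_eq_0_iff[OF q, of 5] by simp_all
  have refl: "t 8 = t 7" "t 9 = t 6" "t 11 = t 4" "t 12 = t 3"
    unfolding t_def using theta_pow_reflect[OF q, of 15 7] theta_pow_reflect[OF q, of 15 6]
      theta_pow_reflect[OF q, of 15 4] theta_pow_reflect[OF q, of 15 3] by simp_all
  have A: "A = t 1 * t 4 * t 6" and B: "B = t 2 * t 3 * t 7"
    using theta_pow_split[OF q, of 5 3] refl
    by (simp_all add: A_def B_def t_def numeral_3_eq_3)
  have T1: "rr_T q = A / B"
    using rr_T_theta_pow[of q 1] q by (simp add: A_def B_def)
  have T3: "rr_T (q ^ 3) = t 3 / t 6"
    using rr_T_theta_pow[of q 3] q by (simp add: t_def)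
  have "t (- 1) = - t 1 / q"
    using theta_pow_minus[OF q, of 15 1] by (simp add: t_def)
  \<comment> \<open>The indices u = 4, y = 1, x = 7, v = 2 produce t1 t4 t3^2 and t2 t7 t6^2, whose
    ratio is T(q) T(q^3)^3.\<close>
  then have "t 7 * t 6 ^ 2 * t 2 - t 6 * t 5 ^ 2 * t 3 = - (q ^ 2 * t 1 * t 4 * t 3 ^ 2)"
    using theta_pow_three_term[OF q, of 15 4 1 7 2] q
    by (simp add: refl power2_eq_square power3_eq_cube mult_ac flip: t_def)
  then have three: "t 7 * t 6 ^ 2 * t 2 + q ^ 2 * t 1 * t 4 * t 3 ^ 2 = t 6 * t 5 ^ 2 * t 3"
    by algebra
  have "rr_T q * rr_T (q ^ 3) ^ 3 = t 1 * t 4 * t 3 ^ 2 / (t 2 * t 7 * t 6 ^ 2)"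
    unfolding T1 T3 A B using nz by (simp add: field_simps power2_eq_square power3_eq_cube)
  then have "(1 + q ^ 2 * (rr_T q * rr_T (q ^ 3) ^ 3)) * (t 2 * t 6 * t 7)
      = (t 7 * t 6 ^ 2 * t 2 + q ^ 2 * t 1 * t 4 * t 3 ^ 2) / t 6"
    using nz by (simp add: field_simps power2_eq_square)
  then have "(1 + q ^ 2 * rr_T q * rr_T (q ^ 3) ^ 3) * (t 2 * t 6 * t 7) = t 3 * t 5 ^ 2"
    unfolding three using nz by (simp add: mult_ac)
  moreover have "(rr_T (q ^ 3) - rr_T q ^ 3) * (t 5 ^ 2 * t 6 * B) = 3 * q * A ^ 2"
  proof -
    have q5: "norm (q ^ 5) < 1" "q ^ 5 \<noteq> 0"
      using q by (auto simp: norm_power power_less_one_iff)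
    \<comment> \<open>Splitting by residues modulo 3 turns the constant of the cubic formula into 1
      / t5^2.\<close>
    have "qpoch_inf (q ^ 5) (q ^ 5) = t 5 * qpoch_inf (q ^ 15) (q ^ 15)"
      using qpoch_inf_split[OF q5(1), of 3 "q ^ 5"] q
      by (simp add: t_def theta_pow_def theta_def numeral_3_eq_3 flip: power_mult power_add power_diff)
    then have E: "(qpoch_inf ((q ^ 5) ^ 3) ((q ^ 5) ^ 3) / qpoch_inf (q ^ 5) (q ^ 5))\<^sup>2 = 1 / t 5 ^ 2"
      using qpoch_inf_nome_nonzero[OF q5(1)] by (simp add: power_divide flip: power_mult)
    have "theta (q / q ^ 2) (q ^ 5) = theta_pow q 5 (- 1)"
      using q by (simp add: theta_pow_def power_int_minus power2_eq_square inverse_eq_divide)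
    then have m: "theta (q / q ^ 2) (q ^ 5) = - A / q"
      using theta_pow_minus[OF q, of 5 1] by (simp add: A_def)
    have r: "theta (q * q ^ 2) (q ^ 5) = B"
      using theta_pow_reflect[OF q, of 5 2] by (simp add: theta_pow_def B_def power3_eq_cube power2_eq_square mult.assoc)
    have th: "theta q (q ^ 5) = A" "theta (q ^ 2) (q ^ 5) = B" "theta ((q ^ 2)\<^sup>2) (q ^ 5) = A"
      "theta (q ^ 3) ((q ^ 5) ^ 3) = t 3" "theta ((q ^ 2) ^ 3) ((q ^ 5) ^ 3) = t 6"
      using theta_pow_reflect[OF q, of 5 1]
      by (simp_all add: A_def B_def t_def theta_pow_def flip: power_mult)
    have "t 3 * B ^ 3 - t 6 * A ^ 3 = - 3 * q ^ 2 * (1 / t 5 ^ 2) * B * A * B * (- A / q)"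
      using theta_cubic[OF q5, of q "q ^ 2", unfolded E m r th] nz q A0 by simp
    also have "\<dots> = 3 * q * A ^ 2 * B ^ 2 / t 5 ^ 2"
      using q by (simp add: power2_eq_square)
    finally have "(t 3 * B ^ 3 - t 6 * A ^ 3) * t 5 ^ 2 = 3 * q * A ^ 2 * B ^ 2"
      using nz by simp
    moreover have "rr_T (q ^ 3) - rr_T q ^ 3 = (t 3 * B ^ 3 - t 6 * A ^ 3) / (t 6 * B ^ 3)"
      unfolding T1 T3 using nz by (simp add: field_simps)
    then have "(rr_T (q ^ 3) - rr_T q ^ 3) * (t 5 ^ 2 * t 6 * B)
        = ((t 3 * B ^ 3 - t 6 * A ^ 3) * t 5 ^ 2) / B ^ 2"
      using nz by (simp add: power2_eq_square power3_eq_cube)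
    ultimately show ?thesis
      using nz by simp
  qed
  ultimately have "((rr_T (q ^ 3) - rr_T q ^ 3) * (1 + q ^ 2 * rr_T q * rr_T (q ^ 3) ^ 3))
      * (t 2 * t 6 * t 7 * (t 5 ^ 2 * t 6 * B)) = 3 * q * A ^ 2 * (t 3 * t 5 ^ 2)"
    by algebra
  also have "\<dots> = 3 * q * rr_T q ^ 2 * rr_T (q ^ 3) ^ 2 * (t 2 * t 6 * t 7 * (t 5 ^ 2 * t 6 * B))"
    unfolding T1 T3 using nz by (simp add: B field_simps power2_eq_square)
  finally show ?thesis
    using nz by simp
qed simp

section \<open>Algebraic consequences of the modular equations\<close>

text \<open>Here $a, b, c, d, e, f, g, h, k$ stand for $R(q^n)$ with $n = 1, 2, 3, 6, 4, 12, 24, 8, 16$.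
  The cofactors were found by linear algebra over the monomials of bounded degree, looking for a
  multiple of the target in the ideal of the known relations whose multiplier does not vanish at
  $q = 0$.\<close>

lemma level_4_certificate:
  fixes a b e :: complex
  assumes "b - a^2 - a*b^2*(b + a^2) = 0" "e - b^2 - b*e^2*(e + b^2) = 0"
  shows "(1 + a*e) * (a*(e^2 + a*b) - e*(1 - a*b^2)) = 0"
proof -
  have "(1 + a*e) * (a*(e^2 + a*b) - e*(1 - a*b^2))
      = - (b + e^3 + b^2*e^2) * (b - a^2 - a*b^2*(b + a^2))
        - (1 - a*b^2 - a^3*b) * (e - b^2 - b*e^2*(e + b^2))"
    by algebra
  then show ?thesis
    by (simp add: assms)
qed

text \<open>Trades the modular equation of degree three for a relation of total degree four, which
  makes the later certificates of level 6 small.\<close>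

lemma level_6_quartic_certificate:
  fixes a b c d :: complex
  assumes "b - a^2 - a*b^2*(b + a^2) = 0" "d - c^2 - c*d^2*(d + c^2) = 0"
    and "(c - a^3)*(1 + a*c^3) - 3*a^2*c^2 = 0"
  shows "(1 - b*c - 2*a^2*c - a*b^2 + a*c*d - a^3*b - a^2*b*d + a*c^3 - a^3*d^2 + 2*a^2*b*c^2 -
      a^3*c^2*d - a^2*b^2*c*d + a^2*c^2*d^2 - a*b*c^4 - a^4*b*c*d + a^3*b*c*d^2 - a^2*b^2*c^3 +
      a^2*c^4*d + a^3*b*c^3*d)*(a*b - c + b*c^2 - b^2*c*d + a*c^2*d) = 0"
proof -
  have "(1 - b*c - 2*a^2*c - a*b^2 + a*c*d - a^3*b - a^2*b*d + a*c^3 - a^3*d^2 + 2*a^2*b*c^2 -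
      a^3*c^2*d - a^2*b^2*c*d + a^2*c^2*d^2 - a*b*c^4 - a^4*b*c*d + a^3*b*c*d^2 - a^2*b^2*c^3 +
      a^2*c^4*d + a^3*b*c^3*d)*(a*b - c + b*c^2 - b^2*c*d + a*c^2*d)
      = (a + d - 2*b*c*d + a^2*c*d - a*c*d^2 + b*c^3 - c*d^3 - c^3*d^2 - a*b*c^2*d^2 + a*c^5 +
        b*c^2*d^3 - a*b*c^4*d + b*c^4*d^2)*(b - a^2 - a*b^2*(b + a^2)) + (a^2 - b + b^2*c -
        a^2*b*c + a*b^3 + a^4*c - a^3*c^3 + a^2*b^2*c^2 - a*b^4*c - a^4*b*c^2)*(d - c^2 -
        c*d^2*(d + c^2)) + (b*c - 1 + a*b*d^2 - b^2*c^2 + b^3*c*d)*((c - a^3)*(1 + a*c^3) -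
        3*a^2*c^2)"
    by algebra
  then show ?thesis
    by (simp add: assms)
qed

text \<open>The second factor is the first identity multiplied by abcd. The multiplier, shared with
  the next two certificates, is 1 when all variables vanish.\<close>

lemma level_6_certificate_1:
  fixes a b c d :: complex
  assumes "b - a^2 - a*b^2*(b + a^2) = 0" "d - c^2 - c*d^2*(d + c^2) = 0"
    and "a*b - c + b*c^2 - b^2*c*d + a*c^2*d = 0"
  shows "(1 - b*c - a*b*d^2 + b^2*c^2 - b^3*c*d)*((a - b*c*d)*(d - a*b*c) - a*b*c*d) = 0"
proof -
  have "(1 - b*c - a*b*d^2 + b^2*c^2 - b^3*c*d)*((a - b*c*d)*(d - a*b*c) - a*b*c*d)
      = - (c*d^2)*(b - a^2 - a*b^2*(b + a^2)) + (a - a*b*c - a^2*b^2 - a^2*c*d + a^2*b^3*c)*(d -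
        c^2 - c*d^2*(d + c^2)) + (a*b*d - a*c - a*d^3 - a*b^2*c*d - a*c^2*d^2 - b^2*c*d^2 +
        a*b^3*c^2*d)*(a*b - c + b*c^2 - b^2*c*d + a*c^2*d)"
    by algebra
  then show ?thesis
    by (simp add: assms)
qed

lemma level_6_certificate_2:
  fixes a b c d :: complex
  assumes "b - a^2 - a*b^2*(b + a^2) = 0" "d - c^2 - c*d^2*(d + c^2) = 0"
    and "a*b - c + b*c^2 - b^2*c*d + a*c^2*d = 0"
  shows "(1 - b*c - a*b*d^2 + b^2*c^2 - b^3*c*d)*(a^2*d + b*c^2 - b*c*(b + a^2)*(a + d)) = 0"
proof -
  have "(1 - b*c - a*b*d^2 + b^2*c^2 - b^3*c*d)*(a^2*d + b*c^2 - b*c*(b + a^2)*(a + d))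
      = (d - c^2 - b*c*d - a*c*d^2 + b*c^3 - c*d^3 - b^2*c^2*d - c^3*d^2)*(b - a^2 - a*b^2*(b +
        a^2)) + (2*a^2 - b - 2*a^2*b*c + a*b^3 - a^3*c*d + a^2*b^2*d)*(d - c^2 - c*d^2*(d +
        c^2)) + (a^2*b*d - b*c - a^2*c - a*b*d^2 + b^2*c^2 - a^2*d^3 - a*b*c^2*d - b^3*c*d -
        a^2*b^2*c*d - a^2*c^2*d^2)*(a*b - c + b*c^2 - b^2*c*d + a*c^2*d)"
    by algebra
  then show ?thesis
    by (simp add: assms)
qed

text \<open>The target is the condition that makes the linear coefficients agree in
  \<open>level_12_identity\<close>.\<close>

lemma level_6_certificate_3:
  fixes a b c d :: complex
  assumes "b - a^2 - a*b^2*(b + a^2) = 0" "d - c^2 - c*d^2*(d + c^2) = 0"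
    and "a*b - c + b*c^2 - b^2*c*d + a*c^2*d = 0"
  shows "(1 - b*c - a*b*d^2 + b^2*c^2 - b^3*c*d)*((b*d - a^2*c^2)*(1 - c*d^2) - 2*a*c^2*d*(1 -
      b*c)) = 0"
proof -
  have "(1 - b*c - a*b*d^2 + b^2*c^2 - b^3*c*d)*((b*d - a^2*c^2)*(1 - c*d^2) - 2*a*c^2*d*(1 -
      b*c))
      = (d - c*d^3)*(b - a^2 - a*b^2*(b + a^2)) + (a^2 - a^2*b*c - a*b^2*d^2 + a^2*b^2*c^2 +
        a^2*b^3*c*d)*(d - c^2 - c*d^2*(d + c^2)) + (2*a*c*d + b^2*d + a^2*b*d - 2*a*b*c^2*d -
        b^2*c*d^3 - a^2*b*c*d^3 + 2*a*b^2*c^3*d)*(a*b - c + b*c^2 - b^2*c*d + a*c^2*d)"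
    by algebra
  then show ?thesis
    by (simp add: assms)
qed

text \<open>This polynomial and the next arise by reducing a relation of level 12 modulo the
  quadratic equation of f: they are, up to monomials, the constant and the linear coefficient of the
  remainder in \<open>level_12_linear_certificate\<close>.\<close>

lemma level_6_consequence_1:
  fixes a b c d :: complex
  assumes "b - a^2 - a*b^2*(b + a^2) = 0" "d - c^2 - c*d^2*(d + c^2) = 0"
    and "a*b - c + b*c^2 - b^2*c*d + a*c^2*d = 0"
    and "(a - b*c*d)*(d - a*b*c) - a*b*c*d = 0" "a^2*d + b*c^2 - b*c*(b + a^2)*(a + d) = 0"
  shows "a^2*b - a*c - c*d + a^3*c^2 + a^2*b^2*c + a^2*c^2*d + a*b^2*c*d + a*c^2*d^2 + 2*a^3*b*c*d
      - a^3*c*d^3 - a^2*b*c^3*d + a^3*b^2*c^2*d + a^4*b*c^2*d^2 = 0"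
proof -
  have "a^2*b - a*c - c*d + a^3*c^2 + a^2*b^2*c + a^2*c^2*d + a*b^2*c*d + a*c^2*d^2 + 2*a^3*b*c*d
      - a^3*c*d^3 - a^2*b*c^3*d + a^3*b^2*c^2*d + a^4*b*c^2*d^2
      = (a*d - 2*a*c^2 - c^2*d - b*c*d^2)*(b - a^2 - a*b^2*(b + a^2)) + (a^3)*(d - c^2 -
        c*d^2*(d + c^2)) + (a + d - 2*a*b*c + a^2*c*d + a*b^2*d + a^3*b*d)*(a*b - c + b*c^2 -
        b^2*c*d + a*c^2*d) + (a^2 - 2*b)*((a - b*c*d)*(d - a*b*c) - a*b*c*d) + (2*a*b*c -
        a)*(a^2*d + b*c^2 - b*c*(b + a^2)*(a + d))"
    by algebra
  then show ?thesis
    by (simp add: assms)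
qed

lemma level_6_consequence_2:
  fixes a b c d :: complex
  assumes "b - a^2 - a*b^2*(b + a^2) = 0" "d - c^2 - c*d^2*(d + c^2) = 0"
    and "a*b - c + b*c^2 - b^2*c*d + a*c^2*d = 0"
    and "(a - b*c*d)*(d - a*b*c) - a*b*c*d = 0" "a^2*d + b*c^2 - b*c*(b + a^2)*(a + d) = 0"
  shows "a*c^3 + c^3*d + a^3*d^2 - a^2*b*c^2 - 2*a^3*c^2*d - a^2*c^2*d^2 + a*c^2*d^3 - a^2*b^2*c^3
      - a*b^2*c^3*d - 2*a^3*b*c^3*d - a^3*c*d^4 - a^2*b*c^3*d^2 - a^3*b^2*c^2*d^2 -
      a^2*b^2*c^2*d^3 = 0"
proof -
  have "a*c^3 + c^3*d + a^3*d^2 - a^2*b*c^2 - 2*a^3*c^2*d - a^2*c^2*d^2 + a*c^2*d^3 - a^2*b^2*c^3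
      - a*b^2*c^3*d - 2*a^3*b*c^3*d - a^3*c*d^4 - a^2*b*c^3*d^2 - a^3*b^2*c^2*d^2 -
      a^2*b^2*c^2*d^3
      = (a*c^2*d + c^2*d^2)*(b - a^2 - a*b^2*(b + a^2)) + (a^3*d - a*c)*(d - c^2 - c*d^2*(d +
        c^2)) + (a^2*c*d^2 - c^2*d - a^2*b*c - a*b*c*d)*(a*b - c + b*c^2 - b^2*c*d + a*c^2*d) +
        (c + a^3)*((a - b*c*d)*(d - a*b*c) - a*b*c*d) + (c^2*d - a^2)*(a^2*d + b*c^2 - b*c*(b +
        a^2)*(a + d))"
    by algebra
  then show ?thesis
    by (simp add: assms)
qed

text \<open>Likewise the two remainder coefficients, up to monomials, in the reduction behind
  \<open>level_12_certificate\<close>.\<close>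

lemma level_6_consequence_3:
  fixes a b c d :: complex
  assumes "b - a^2 - a*b^2*(b + a^2) = 0" "d - c^2 - c*d^2*(d + c^2) = 0"
    and "a*b - c + b*c^2 - b^2*c*d + a*c^2*d = 0"
    and "(a - b*c*d)*(d - a*b*c) - a*b*c*d = 0" "a^2*d + b*c^2 - b*c*(b + a^2)*(a + d) = 0"
  shows "2*a*b*c^2 - a*b*d - c^3 + b*c^2*d - a*c^2*d^2 + a*b*c*d^3 + a^2*b*c^3*d + a*b*c^3*d^2 = 0"
proof -
  have "2*a*b*c^2 - a*b*d - c^3 + b*c^2*d - a*c^2*d^2 + a*b*c*d^3 + a^2*b*c^3*d + a*b*c^3*d^2
      = (c^2*d - c^4)*(b - a^2 - a*b^2*(b + a^2)) + (a^2*c^2 - a*b - a*b^2*c)*(d - c^2 -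
        c*d^2*(d + c^2)) + (c^2 - a*b*c + a*c*d^2 - b*c^3 + a*c^3*d)*(a*b - c + b*c^2 - b^2*c*d
        + a*c^2*d) + (a^2 + a*c^2)*((a - b*c*d)*(d - a*b*c) - a*b*c*d) + (b*c^3 - a -
        c^2)*(a^2*d + b*c^2 - b*c*(b + a^2)*(a + d))"
    by algebra
  then show ?thesis
    by (simp add: assms)
qed

lemma level_6_consequence_4:
  fixes a b c d :: complex
  assumes "b - a^2 - a*b^2*(b + a^2) = 0" "d - c^2 - c*d^2*(d + c^2) = 0"
    and "a*b - c + b*c^2 - b^2*c*d + a*c^2*d = 0"
    and "(a - b*c*d)*(d - a*b*c) - a*b*c*d = 0" "a^2*d + b*c^2 - b*c*(b + a^2)*(a + d) = 0"
  shows "a^2*b*d - a*c*d + a*c^3 + c^3*d - a^2*b*c^2 - a*b*c^2*d + a*c^2*d^3 - 2*a^2*b*c*d^3 -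
      a^2*c^4*d - a^2*b*c^3*d^2 + a*b*c^3*d^3 + a*b*c^5*d^2 + a^2*b*c^2*d^5 + a^2*b*c^4*d^4 = 0"
proof -
  have "a^2*b*d - a*c*d + a*c^3 + c^3*d - a^2*b*c^2 - a*b*c^2*d + a*c^2*d^3 - 2*a^2*b*c*d^3 -
      a^2*c^4*d - a^2*b*c^3*d^2 + a*b*c^3*d^3 + a*b*c^5*d^2 + a^2*b*c^2*d^5 + a^2*b*c^4*d^4
      = (a^2*b - 2*a*b*c^2 - b*c^2*d - a^2*b*c*d^2 + a*b^2*c^3)*(d - c^2 - c*d^2*(d + c^2)) +
        (a*b*c^3 - a*c^2 - c^2*d)*(a*b - c + b*c^2 - b^2*c*d + a*c^2*d) + (b*c^2 - c + c^2*d^2 +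
        c^4*d)*((a - b*c*d)*(d - a*b*c) - a*b*c*d)"
    by algebra
  then show ?thesis
    by (simp add: assms)
qed

text \<open>The vanishing of \<open>?X\<close> says that the quotient \<open>?N / ?D\<close>
  satisfies the quadratic equation of e. Its two roots have product ab, so the quotient is either e
  or ab/e; the conclusion leaves both branches open.\<close>

lemma level_12_linear_certificate:
  fixes a b c d e f :: complex
  assumes rels: "b - a^2 - a*b^2*(b + a^2) = 0" "d - c^2 - c*d^2*(d + c^2) = 0"
      "a*b - c + b*c^2 - b^2*c*d + a*c^2*d = 0"
      "(a - b*c*d)*(d - a*b*c) - a*b*c*d = 0" "a^2*d + b*c^2 - b*c*(b + a^2)*(a + d) = 0"
    and quad: "a*(e^2 + a*b) - e*(1 - a*b^2) = 0" "c*(f^2 + c*d) - f*(1 - c*d^2) = 0"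
    and "c \<noteq> 0"
  shows "a * (c*d + a*c - a*d*f - (1 - c*f + a*c*d)*e)
      * (e*(c*d + a*c - a*d*f) - a*b*(1 - c*f + a*c*d)) = 0"
proof -
  let ?N = "c*d + a*c - a*d*f" and ?D = "1 - c*f + a*c*d"
  let ?X = "a*(?N^2 + a*b*?D^2) - ?N*?D*(1 - a*b^2)"
  have "c * ?X = (a^3*d^2 - a*c*d + a^2*b*c^2 + a^2*b^2*c*d) * (c*(f^2 + c*d) - f*(1 - c*d^2))
      + f*(a*c^3 + c^3*d + a^3*d^2 - a^2*b*c^2 - 2*a^3*c^2*d - a^2*c^2*d^2 + a*c^2*d^3 -
        a^2*b^2*c^3 - a*b^2*c^3*d - 2*a^3*b*c^3*d - a^3*c*d^4 - a^2*b*c^3*d^2 -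
        a^3*b^2*c^2*d^2 - a^2*b^2*c^2*d^3)
      + c*(a^2*b - a*c - c*d + a^3*c^2 + a^2*b^2*c + a^2*c^2*d + a*b^2*c*d + a*c^2*d^2 +
        2*a^3*b*c*d - a^3*c*d^3 - a^2*b*c^3*d + a^3*b^2*c^2*d + a^4*b*c^2*d^2)"
    by algebra
  then have "?X = 0"
    unfolding level_6_consequence_1[OF rels] level_6_consequence_2[OF rels] quad using \<open>c \<noteq> 0\<close> by simp
  moreover have "a * (?N - ?D*e) * (e*?N - a*b*?D)
      = e*?X - ?N*?D*(a*(e^2 + a*b) - e*(1 - a*b^2))"
    by algebra
  ultimately show ?thesis
    unfolding quad by simp
qed

text \<open>The target is linear in e, namely \<open>?L\<close> e - \<open>?M\<close>. Substituting
  e = \<open>?N / ?D\<close> from the linear relation leaves only a, b, c, d, f, and f is reduced by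
  its quadratic equation.\<close>

lemma level_12_certificate:
  fixes a b c d e f :: complex
  assumes rels: "b - a^2 - a*b^2*(b + a^2) = 0" "d - c^2 - c*d^2*(d + c^2) = 0"
      "a*b - c + b*c^2 - b^2*c*d + a*c^2*d = 0"
      "(a - b*c*d)*(d - a*b*c) - a*b*c*d = 0" "a^2*d + b*c^2 - b*c*(b + a^2)*(a + d) = 0"
    and quad: "c*(f^2 + c*d) - f*(1 - c*d^2) = 0"
    and lin: "c*d + a*c - a*d*f - (1 - c*f + a*c*d)*e = 0"
    and "c \<noteq> 0"
  shows "(1 - c*f + a*c*d) * (a^2*b*c^2*d + e*f - a*c*(d^2 + f)*(1 + b*e*f^2)) = 0"
proof -
  let ?N = "c*d + a*c - a*d*f" and ?D = "1 - c*f + a*c*d"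
  let ?M = "a*c*(d^2 + f) - a^2*b*c^2*d" and ?L = "f - a*b*c*f^2*(d^2 + f)"
  have "c^3 * (?N*?L - ?M*?D) = (a^2*b*c*d - a*c^2*d + a*c^4 - a^2*b*c^3 - a*b*c^3*d + a^2*b*c^2*d*f - a^2*b*c^4*f -
        a^2*b*c^2*d^3 - a*b*c^4*d*f - a^2*b*c^4*d^2 + a^2*b*c^3*d*f^2) * (c*(f^2 + c*d) - f*(1 - c*d^2))
      + f*c*(a^2*b*d - a*c*d + a*c^3 + c^3*d - a^2*b*c^2 - a*b*c^2*d + a*c^2*d^3 - 2*a^2*b*c*d^3 -
        a^2*c^4*d - a^2*b*c^3*d^2 + a*b*c^3*d^3 + a*b*c^5*d^2 + a^2*b*c^2*d^5 + a^2*b*c^4*d^4)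
      + a*c^3*d*(2*a*b*c^2 - a*b*d - c^3 + b*c^2*d - a*c^2*d^2 + a*b*c*d^3 + a^2*b*c^3*d + a*b*c^3*d^2)"
    by algebra
  then have "?N*?L - ?M*?D = 0"
    unfolding level_6_consequence_3[OF rels] level_6_consequence_4[OF rels] quad using \<open>c \<noteq> 0\<close> by simp
  moreover have "?D * (a^2*b*c^2*d + e*f - a*c*(d^2 + f)*(1 + b*e*f^2))
      = ?N*?L - ?M*?D - ?L*(?N - ?D*e)"
    by algebra
  ultimately show ?thesis
    unfolding lin by simp
qed

section \<open>Common zeros of numerators and denominators, and the equation x^2 + 11x - 1 =
  0\<close>

lemma modular_2_cusp:
  fixes a b :: complex
  assumes mod: "b - a^2 - a*b^2*(b + a^2) = 0" and nz: "a \<noteq> 0" "b \<noteq> 0"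
    and cusp: "(a^5)^2 + 11*a^5 - 1 = 0"
  shows "(b^5)^2 + 11*b^5 - 1 = 0"
proof -
  \<comment> \<open>Ramanujan's parameter k = R(q) R(q^2)^2, which makes both a^5 and b^5 rational
    in k. The two cusp polynomials then have the same irreducible factors, 1 + k - k^2 and 1 - 4k -
    k^2, up to powers of 1 + k and 1 - k.\<close>
  define k where "k = a*b^2"
  have 1: "b*(1 - k) = a^2*(1 + k)"
    using mod unfolding k_def by algebra
  have "k \<noteq> 1"
    using 1 nz by auto
  have a: "a^5*(1 + k)^2 = k*(1 - k)^2"
    using 1 unfolding k_def by algebra
  have b: "b^5*(1 - k) = k^2*(1 + k)"
    using 1 unfolding k_def by algebra
  have "(1 + k - k^2)*(1 - 4*k - k^2)^2 = - ((1 + k)^4*((a^5)^2 + 11*a^5 - 1))"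
    using a by algebra
  then have "(1 + k - k^2)*(1 - 4*k - k^2) = 0"
    using cusp by simp
  moreover have "(1 - k)^2*((b^5)^2 + 11*b^5 - 1) = - ((1 + k - k^2)^2*(1 - 4*k - k^2))"
    using b by algebra
  ultimately show ?thesis
    using \<open>k \<noteq> 1\<close> by auto
qed

text \<open>The two vanishing conditions give eh = a^2, and what remains of them is a perfect square
  forcing k = a. The quadratic and the modular equation then overdetermine e.\<close>

lemma denominator_level_16_cusp:
  fixes a e h k :: complex
  assumes quad: "e*(k^2 + e*h) = k*(1 - e*h^2)" and mod: "k - h^2 = h*k^2*(k + h^2)"
    and nz: "a \<noteq> 0" "e \<noteq> 0" "h \<noteq> 0" "k \<noteq> 0"
    and num: "e^2*h - 2*a*e*k + e*k^2 = 0"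
    and den: "a^2*e*h - 2*a*e*h*k + a^2*k^2 = 0"
  shows "(a^5)^2 + 11*a^5 - 1 = 0"
proof -
  have n: "e*h + k^2 = 2*a*k"
    using num nz by algebra
  then have "2*a*k*(a^2 - e*h) = 0"
    using den by algebra
  then have eh: "e*h = a^2"
    using nz by simp
  then have "(k - a)^2 = 0"
    using n by algebra
  then have k: "k = a"
    by simp
  have "a*(2*e^2*a - (e - a^4)) = 0"
    using quad eh unfolding k by algebra
  then have q: "2*e^2*a = e - a^4"
    using nz by simp
  have "a*(e^3 - e*a^3 - a^4*e^2 - a^7) = 0"
    using mod eh unfolding k by algebra
  then have "e^3 - e*a^3 - a^4*e^2 - a^7 = 0"
    using nz by simp
  then have l: "e*(1 - 8*a^5) = a^4*(1 + 2*a^5)"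
    using q by algebra
  have "a^9*(4*((a^5)^2 + 11*a^5 - 1)) = 0"
    using q l by algebra
  then show ?thesis
    using nz unfolding mult_eq_0_iff by simp
qed

text \<open>In the scale-free quantity t = b / a^2 the two conditions become t^2 = t + 1. The
  modular equation makes a^5 a rational function of this t in Q(sqrt 5), and its minimal polynomial
  is the cusp polynomial.\<close>

lemma denominator_level_6_cusp:
  fixes a b c :: complex
  assumes mod: "b - a^2 = a*b^2*(b + a^2)" and nz: "a \<noteq> 0"
    and num: "a*b - c + a^3 = 0" and den: "a^2*c - b*c + a^3*b = 0"
  shows "(a^5)^2 + 11*a^5 - 1 = 0"
proof -
  define t where "t = b / a^2"
  have b: "b = t*a^2"
    using nz by (simp add: t_def)
  have "a^5*(t^2 - t - 1) = 0"
    using num den unfolding b by algebra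
  then have "t^2 - t - 1 = 0"
    using nz by simp
  then have t: "t^2 = t + 1"
    by algebra
  have "a^2*(a^5*(3*t + 2) - (t - 1)) = 0"
    using mod t unfolding b by algebra
  then have x: "a^5*(3*t + 2) = t - 1"
    using nz by simp
  have "(3*t + 2)^2*((a^5)^2 + 11*a^5 - 1) = 0"
    using x t by algebra
  moreover have "3*t + 2 \<noteq> 0"
  proof
    assume "3*t + 2 = 0"
    then have "(1::complex) = 0"
      using t by algebra
    then show False
      by simp
  qed
  ultimately show ?thesis
    by simp
qed

lemma denominator_level_12_cusp:
  fixes a c d f :: complex
  assumes cubic: "(c - a^3)*(1 + a*c^3) = 3*a^2*c^2" and mod: "d - c^2 = c*d^2*(d + c^2)"
    and quad: "c*(f^2 + c*d) = f*(1 - c*d^2)"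
    and nz: "a \<noteq> 0" "c \<noteq> 0" "f \<noteq> 0"
    and num: "a*c^2*d + 2*d*f + a*c*f^2 = 0"
    and den: "c*d + 2*a*c^2*f + f^2 = 0"
  shows "(a^5)^2 + 11*a^5 - 1 = 0"
proof -
  have "2*f*(d - a^2*c^3) = 0"
    using num den by algebra
  then have d: "d = a^2*c^3"
    using nz by simp
  have "(f + a*c^2)^2 = 0"
    using den unfolding d by algebra
  then have f: "f = - (a*c^2)"
    by (simp add: eq_neg_iff_add_eq_0)
  \<comment> \<open>Once d and f are monomials in a and c, every remaining equation is, up to a
    monomial factor, a polynomial in \<open>u\<close> and \<open>w\<close>.\<close>
  define u where "u = a*c^3"
  define w where "w = a^2*c"
  have "a*c^2*(1 + 2*u - u^2*w) = 0"
    using quad unfolding d f u_def w_def by algebra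
  then have 1: "u^2*w = 1 + 2*u"
    using nz by simp
  have "c^2*(w - 1 - u^2*w*(w + 1)) = 0"
    using mod unfolding d u_def w_def by algebra
  then have "w - 1 = u^2*w*(w + 1)"
    using nz by simp
  then have "2*(u*w + u + 1) = 0"
    using 1 by algebra
  then have 2: "u*w + u + 1 = 0"
    unfolding mult_eq_0_iff by simp
  have "a^2*c^2*(w^2 - u - 3) = 0"
    using cubic 2 unfolding u_def w_def by algebra
  then have "w^2 - u - 3 = 0"
    using nz by simp
  then have u: "u = w^2 - 3"
    by algebra
  have "(w + 2)*(w^2 - w - 1) = 0"
    using 2 unfolding u by algebra
  moreover have "w + 2 \<noteq> 0"
  proof
    assume "w + 2 = 0"
    then have "(5::complex) = 0"
      using 1 unfolding u by algebra
    then show False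
      by simp
  qed
  ultimately have "w^2 - w - 1 = 0"
    by simp
  then have w: "w^2 = w + 1"
    by algebra
  have "c*(a^5*u - w^3) = 0"
    unfolding u_def w_def by algebra
  then have "a^5*u - w^3 = 0"
    using nz by simp
  then have x: "a^5*(w - 2) = w^3"
    using u w by algebra
  have "(w - 2)^2*((a^5)^2 + 11*a^5 - 1) = 0"
    using x w by algebra
  moreover have "w - 2 \<noteq> 0"
    using w by auto
  ultimately show ?thesis
    by simp
qed

text \<open>The values a, c, e enter only through t = ef / (ac), so the conclusion concerns f =
  R(q^12) instead of a. A perfect square again collapses the conditions, to g = tf and d = t^2
  f.\<close>

lemma denominator_level_24_cusp:
  fixes a c d e f g :: complex
  assumes mod: "f - d^2 = d*f^2*(f + d^2)" "g - f^2 = f*g^2*(g + f^2)"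
    and quad: "d*(g^2 + d*f) = g*(1 - d*f^2)"
    and nz: "a \<noteq> 0" "c \<noteq> 0" "d \<noteq> 0" "e \<noteq> 0" "f \<noteq> 0" "g \<noteq> 0"
    and num: "2*a*c*d*g - e*d*f^2 - e*f*g^2 = 0"
    and den: "a*c*d*f - 2*e*f^2*g + a*c*g^2 = 0"
  shows "(f^5)^2 + 11*f^5 - 1 = 0"
proof -
  define t where "t = e*f / (a*c)"
  have e: "e*f = t*(a*c)"
    using nz by (simp add: t_def)
  have "t \<noteq> 0"
    using nz by (simp add: t_def)
  have "a*c*(d*f - 2*t*f*g + g^2) = 0"
    using den e by algebra
  then have "d*f - 2*t*f*g + g^2 = 0"
    using nz by simp
  then have 1: "d*f + g^2 = 2*t*f*g"
    by algebra
  have "a*c*(2*d*g - t*(d*f + g^2)) = 0"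
    using num e by algebra
  then have "2*g*(d - t^2*f) = 0"
    using 1 nz by algebra
  then have d: "d = t^2*f"
    using nz by simp
  have "(g - t*f)^2 = 0"
    using 1 unfolding d by algebra
  then have g: "g = t*f"
    by simp
  have "t*f*(2*t^3*f^2 - (1 - t^2*f^3)) = 0"
    using quad unfolding d g by algebra
  then have "2*t^3*f^2 - (1 - t^2*f^3) = 0"
    using nz \<open>t \<noteq> 0\<close> by simp
  then have 2: "t^2*f^3 = 1 - 2*t^3*f^2"
    by algebra
  have "f*(t - f - t^2*f^3*(t + f)) = 0"
    using mod(2) unfolding g by algebra
  then have "t - f = (1 - 2*t^3*f^2)*(t + f)"
    using nz 2 by simp
  then have "2*f*(t^3*f*(t + f) - 1) = 0"
    by algebra
  then have 3: "t^3*f*(t + f) = 1"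
    using nz by simp
  have "f*(1 - t^4*f - t^2*f^3*(1 + t^4*f)) = 0"
    using mod(1) unfolding d by algebra
  then have "1 - t^4*f = (1 - 2*t^3*f^2)*(1 + t^4*f)"
    using nz 2 by simp
  then have "2*t^3*f*(t - f*(1 + t^4*f)) = 0"
    by algebra
  then have 4: "t = f*(1 + t^4*f)"
    using nz \<open>t \<noteq> 0\<close> by simp
  define u where "u = t^4*f"
  have t: "t = f*(1 + u)"
    using 4 unfolding u_def .
  have "t^3*f^2 = 1 - u"
    using 3 unfolding u_def by algebra
  moreover have "t^3*f^2*(1 + u) = u"
    using t unfolding u_def by algebra
  ultimately have u: "u^2 + u - 1 = 0"
    by algebra
  have "f^5*(1 + u)^4 = u"
    using t unfolding u_def by algebra
  moreover have "(1 + u)^4 = 5 + 3*u"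
    using u by algebra
  ultimately have x: "f^5*(5 + 3*u) = u"
    by simp
  have "(5 + 3*u)^2*((f^5)^2 + 11*f^5 - 1)
      = (f^5*(5 + 3*u) - u)*(f^5*(5 + 3*u) + u + 11*(5 + 3*u)) + 25*(u^2 + u - 1)"
    by algebra
  then have "(5 + 3*u)^2*((f^5)^2 + 11*f^5 - 1) = 0"
    using x u by simp
  moreover have "5 + 3*u \<noteq> 0"
  proof
    assume "5 + 3*u = 0"
    then have "(1::complex) = 0"
      using u by algebra
    then show False
      by simp
  qed
  ultimately show ?thesis
    by simp
qed

section \<open>Relations between the values of the continued fraction\<close>

text \<open>R(q^n) as a function of the fifth root r alone; there is no branch to choose, and levels
  are changed by replacing r with a power.\<close>

definition rr_cf :: "nat \<Rightarrow> complex \<Rightarrow> complex" where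
  "rr_cf n r = r ^ n * rr_T (r ^ (5 * n))"

lemma rr_R_eq_rr_cf: "rr_R r (r ^ 5) n = rr_cf n r"
  by (simp add: rr_R_def rr_cf_def power_mult)

lemma rr_cf_power: "rr_cf m (r ^ n) = rr_cf (m * n) r"
  by (simp add: rr_cf_def mult_ac flip: power_mult)

lemma rr_cf_0 [simp]: "n > 0 \<Longrightarrow> rr_cf n 0 = 0"
  by (simp add: rr_cf_def)

lemma rr_cf_nonzero: "norm r < 1 \<Longrightarrow> r \<noteq> 0 \<Longrightarrow> n > 0 \<Longrightarrow> rr_cf n r \<noteq> 0"
  by (simp add: rr_cf_def rr_T_nonzero norm_power power_less_one_iff)

lemma holomorphic_rr_T_power:
  assumes "n > 0"
  shows "(\<lambda>r. rr_T (r ^ n)) holomorphic_on ball 0 1"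
proof -
  have "rr_T \<circ> (\<lambda>r. r ^ n) holomorphic_on ball 0 1"
    by (rule holomorphic_on_compose_gen[OF _ holomorphic_rr_T])
       (use assms in \<open>auto intro!: holomorphic_intros simp: norm_power power_less_one_iff\<close>)
  then show ?thesis
    by (simp add: o_def)
qed

lemma holomorphic_rr_cf [holomorphic_intros]: "(\<lambda>r. rr_cf n r) holomorphic_on ball 0 1"
proof (cases "n = 0")
  case False
  then show ?thesis
    unfolding rr_cf_def by (intro holomorphic_intros holomorphic_rr_T_power) auto
qed (simp add: rr_cf_def)

lemma rr_cf_modular_2:
  assumes "norm r < 1" "n > 0"
  shows "rr_cf (2*n) r - rr_cf n r ^ 2
    - rr_cf n r * rr_cf (2*n) r ^ 2 * (rr_cf (2*n) r + rr_cf n r ^ 2) = 0"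
proof -
  define s where "s = r ^ n"
  have "norm (s ^ 5) < 1"
    using assms by (simp add: s_def norm_power power_less_one_iff)
  \<comment> \<open>Multiplication by s^2 distributes the powers of s so that the factor q = s^5 is
    absorbed.\<close>
  from rr_T_modular_2[OF this]
  have "s^2 * rr_T (s ^ 10) - (s * rr_T (s ^ 5))^2
      - s * rr_T (s ^ 5) * (s^2 * rr_T (s ^ 10))^2 * (s^2 * rr_T (s ^ 10) + (s * rr_T (s ^ 5))^2) = 0"
    unfolding power_mult[symmetric] by simp algebra
  then have "rr_cf 2 s - rr_cf 1 s ^ 2 - rr_cf 1 s * rr_cf 2 s ^ 2 * (rr_cf 2 s + rr_cf 1 s ^ 2) = 0"
    by (simp add: rr_cf_def)
  then show ?thesis
    unfolding s_def rr_cf_power by simp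
qed

lemma rr_cf_modular_3:
  assumes "norm r < 1" "n > 0"
  shows "(rr_cf (3*n) r - rr_cf n r ^ 3) * (1 + rr_cf n r * rr_cf (3*n) r ^ 3)
    - 3 * rr_cf n r ^ 2 * rr_cf (3*n) r ^ 2 = 0"
proof -
  define s where "s = r ^ n"
  have "norm (s ^ 5) < 1"
    using assms by (simp add: s_def norm_power power_less_one_iff)
  from rr_T_modular_3[OF this]
  have "(s^3 * rr_T (s ^ 15) - (s * rr_T (s ^ 5))^3) * (1 + s * rr_T (s ^ 5) * (s^3 * rr_T (s ^ 15))^3)
      - 3 * (s * rr_T (s ^ 5))^2 * (s^3 * rr_T (s ^ 15))^2 = 0"
    unfolding power_mult[symmetric] by simp algebra
  then have "(rr_cf 3 s - rr_cf 1 s ^ 3) * (1 + rr_cf 1 s * rr_cf 3 s ^ 3)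
      - 3 * rr_cf 1 s ^ 2 * rr_cf 3 s ^ 2 = 0"
    by (simp add: rr_cf_def)
  then show ?thesis
    unfolding s_def rr_cf_power by simp
qed

section \<open>Selecting branches on the unit disc\<close>

lemma disc_factor_zero:
  fixes F G :: "complex \<Rightarrow> complex"
  assumes hol: "F holomorphic_on ball 0 1" "G holomorphic_on ball 0 1" and "G 0 \<noteq> 0"
    and prod: "\<And>r. norm r < 1 \<Longrightarrow> G r * F r = 0" and z: "norm z < 1"
  shows "F z = 0"
proof -
  have cont: "continuous_on (ball 0 1) G"
    using hol(2) by (rule holomorphic_on_imp_continuous_on)
  define U where "U = ball 0 1 \<inter> G -` (- {0})"
  have "open U"
    unfolding U_def by (intro continuous_open_preimage[OF cont]) auto
  moreover have "0 \<in> U" "U \<subseteq> ball 0 1"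
    using assms(3) by (auto simp: U_def)
  moreover have "F r = 0" if "r \<in> U" for r
    using prod[of r] that by (auto simp: U_def)
  ultimately show ?thesis
    using hol(1) z by (intro analytic_continuation_open[of U "ball 0 1" F "\<lambda>_. 0" z]) auto
qed

text \<open>The tool for doubling twice: with n = 1, 2, 3, 4, 6 it supplies the quadratic equations
  of R(q^4), R(q^8), R(q^12), R(q^16) and R(q^24).\<close>

lemma rr_cf_level_4:
  assumes "norm r < 1" "n > 0"
  shows "rr_cf n r * (rr_cf (4*n) r ^ 2 + rr_cf n r * rr_cf (2*n) r)
    - rr_cf (4*n) r * (1 - rr_cf n r * rr_cf (2*n) r ^ 2) = 0"
proof -
  have "norm (r ^ n) < 1"
    using assms by (simp add: norm_power power_less_one_iff)
  moreover have "rr_cf 1 z * (rr_cf 4 z ^ 2 + rr_cf 1 z * rr_cf 2 z)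
    - rr_cf 4 z * (1 - rr_cf 1 z * rr_cf 2 z ^ 2) = 0" if "norm z < 1" for z
  proof (rule disc_factor_zero[where G = "\<lambda>r. 1 + rr_cf 1 r * rr_cf 4 r", OF _ _ _ _ that])
    show "(1 + rr_cf 1 r * rr_cf 4 r) * (rr_cf 1 r * (rr_cf 4 r ^ 2 + rr_cf 1 r * rr_cf 2 r)
        - rr_cf 4 r * (1 - rr_cf 1 r * rr_cf 2 r ^ 2)) = 0" if "norm r < 1" for r
      using level_4_certificate[of "rr_cf 2 r" "rr_cf 1 r" "rr_cf 4 r"]
        rr_cf_modular_2[OF that, of 1] rr_cf_modular_2[OF that, of 2] by simp
  qed (auto intro!: holomorphic_intros)
  ultimately show ?thesis
    by (metis mult_1 rr_cf_power)
qed

lemma rr_cf_level_6_quartic: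
  assumes "norm z < 1"
  shows "rr_cf 1 z * rr_cf 2 z - rr_cf 3 z + rr_cf 2 z * rr_cf 3 z^2
    - rr_cf 2 z^2 * rr_cf 3 z * rr_cf 6 z + rr_cf 1 z * rr_cf 3 z^2 * rr_cf 6 z = 0"
  by (rule disc_factor_zero[OF _ _ _ level_6_quartic_certificate assms])
     (auto intro!: holomorphic_intros
       simp: rr_cf_modular_2[of _ 1, simplified] rr_cf_modular_2[of _ 3, simplified]
         rr_cf_modular_3[of _ 1, simplified])

lemma rr_cf_level_6:
  assumes "norm z < 1"
  shows "(rr_cf 1 z - rr_cf 2 z * rr_cf 3 z * rr_cf 6 z)
      * (rr_cf 6 z - rr_cf 1 z * rr_cf 2 z * rr_cf 3 z)
      - rr_cf 1 z * rr_cf 2 z * rr_cf 3 z * rr_cf 6 z = 0"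
    and "rr_cf 1 z^2 * rr_cf 6 z + rr_cf 2 z * rr_cf 3 z^2
      - rr_cf 2 z * rr_cf 3 z * (rr_cf 2 z + rr_cf 1 z^2) * (rr_cf 1 z + rr_cf 6 z) = 0"
    and "(rr_cf 2 z * rr_cf 6 z - rr_cf 1 z^2 * rr_cf 3 z^2) * (1 - rr_cf 3 z * rr_cf 6 z^2)
      - 2 * rr_cf 1 z * rr_cf 3 z^2 * rr_cf 6 z * (1 - rr_cf 2 z * rr_cf 3 z) = 0"
proof -
  note rels = rr_cf_modular_2[of _ 1, simplified] rr_cf_modular_2[of _ 3, simplified]
    rr_cf_level_6_quartic[simplified]
  show "(rr_cf 1 z - rr_cf 2 z * rr_cf 3 z * rr_cf 6 z)
      * (rr_cf 6 z - rr_cf 1 z * rr_cf 2 z * rr_cf 3 z)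
      - rr_cf 1 z * rr_cf 2 z * rr_cf 3 z * rr_cf 6 z = 0"
    by (rule disc_factor_zero[OF _ _ _ level_6_certificate_1 assms])
       (auto intro!: holomorphic_intros simp: rels)
  show "rr_cf 1 z^2 * rr_cf 6 z + rr_cf 2 z * rr_cf 3 z^2
      - rr_cf 2 z * rr_cf 3 z * (rr_cf 2 z + rr_cf 1 z^2) * (rr_cf 1 z + rr_cf 6 z) = 0"
    by (rule disc_factor_zero[OF _ _ _ level_6_certificate_2 assms])
       (auto intro!: holomorphic_intros simp: rels)
  show "(rr_cf 2 z * rr_cf 6 z - rr_cf 1 z^2 * rr_cf 3 z^2) * (1 - rr_cf 3 z * rr_cf 6 z^2)
      - 2 * rr_cf 1 z * rr_cf 3 z^2 * rr_cf 6 z * (1 - rr_cf 2 z * rr_cf 3 z) = 0"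
    by (rule disc_factor_zero[OF _ _ _ level_6_certificate_3 assms])
       (auto intro!: holomorphic_intros simp: rels)
qed

text \<open>The unwanted factor, R(q^4) \<open>N\<close> - R(q) R(q^2) \<open>D\<close>, vanishes at
  r = 0. Since R(q^4) = R(q) R(q^2) \<open>h\<close> with \<open>h\<close> holomorphic, it equals
  R(q) R(q^2) times \<open>h\<close> \<open>N\<close> - \<open>D\<close>, and the latter is -1 at 0.
  The monomial is moved to the other factor and cancelled at the end, where z is nonzero.\<close>

lemma rr_cf_level_12_linear:
  assumes z: "norm z < 1" "z \<noteq> 0"
  shows "rr_cf 3 z * rr_cf 6 z + rr_cf 1 z * rr_cf 3 z - rr_cf 1 z * rr_cf 6 z * rr_cf 12 z
    - (1 - rr_cf 3 z * rr_cf 12 z + rr_cf 1 z * rr_cf 3 z * rr_cf 6 z) * rr_cf 4 z = 0"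
proof -
  define N where "N = (\<lambda>r. rr_cf 3 r * rr_cf 6 r + rr_cf 1 r * rr_cf 3 r - rr_cf 1 r * rr_cf 6 r * rr_cf 12 r)"
  define D where "D = (\<lambda>r. 1 - rr_cf 3 r * rr_cf 12 r + rr_cf 1 r * rr_cf 3 r * rr_cf 6 r)"
  define h where "h = (\<lambda>r. r * rr_T (r ^ 20) / (rr_T (r ^ 5) * rr_T (r ^ 10)))"
  have nzT: "rr_T (r ^ k) \<noteq> 0" if "norm r < 1" "k > 0" for r k
    using that by (intro rr_T_nonzero) (simp add: norm_power power_less_one_iff)
  have e: "rr_cf 4 r = rr_cf 1 r * rr_cf 2 r * h r" if "norm r < 1" for r
    using nzT[OF that, of 5] nzT[OF that, of 10]
    by (simp add: rr_cf_def h_def power2_eq_square power4_eq_xxxx)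
  have h: "h holomorphic_on ball 0 1"
    unfolding h_def using nzT by (intro holomorphic_intros holomorphic_rr_T_power) auto
  have "rr_cf 1 z ^ 2 * rr_cf 2 z * (N z - D z * rr_cf 4 z) = 0"
  proof (rule disc_factor_zero[where G = "\<lambda>r. h r * N r - D r", OF _ _ _ _ z(1)])
    fix r :: complex assume r: "norm r < 1"
    show "(h r * N r - D r) * (rr_cf 1 r ^ 2 * rr_cf 2 r * (N r - D r * rr_cf 4 r)) = 0"
    proof (cases "r = 0")
      case False
      have "rr_cf 1 r * (N r - D r * rr_cf 4 r) * (rr_cf 4 r * N r - rr_cf 1 r * rr_cf 2 r * D r) = 0"
        unfolding N_def D_def
        by (rule level_12_linear_certificate)
           (use r False rr_cf_modular_2[OF r, of 1] rr_cf_modular_2[OF r, of 3] rr_cf_level_6_quartic[OF r]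
             rr_cf_level_6[OF r] rr_cf_level_4[OF r, of 1] rr_cf_level_4[OF r, of 3] rr_cf_nonzero
             in simp_all)
      then show ?thesis
        unfolding e[OF r] by algebra
    qed simp
  next
    show "(\<lambda>r. h r * N r - D r) holomorphic_on ball 0 1"
      unfolding N_def D_def by (intro holomorphic_intros h)
    show "h 0 * N 0 - D 0 \<noteq> 0"
      by (simp add: N_def D_def)
  qed (auto intro!: holomorphic_intros simp: N_def D_def)
  then show ?thesis
    using rr_cf_nonzero[OF z] by (simp add: N_def D_def)
qed

lemma rr_cf_level_12:
  assumes z: "norm z < 1"
  shows "rr_cf 1 z^2 * rr_cf 2 z * rr_cf 3 z^2 * rr_cf 6 z + rr_cf 4 z * rr_cf 12 z
    - rr_cf 1 z * rr_cf 3 z * (rr_cf 6 z^2 + rr_cf 12 z) * (1 + rr_cf 2 z * rr_cf 4 z * rr_cf 12 z^2) = 0"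
    (is "?F z = 0")
proof (rule disc_factor_zero[where G = "\<lambda>r. 1 - rr_cf 3 r * rr_cf 12 r + rr_cf 1 r * rr_cf 3 r * rr_cf 6 r",
      OF _ _ _ _ z])
  fix r :: complex assume r: "norm r < 1"
  show "(1 - rr_cf 3 r * rr_cf 12 r + rr_cf 1 r * rr_cf 3 r * rr_cf 6 r) * ?F r = 0"
  proof (cases "r = 0")
    case False
    show ?thesis
      by (rule level_12_certificate)
         (use r False rr_cf_modular_2[OF r, of 1] rr_cf_modular_2[OF r, of 3] rr_cf_level_6_quartic[OF r]
           rr_cf_level_6[OF r] rr_cf_level_4[OF r, of 3] rr_cf_level_12_linear[OF r] rr_cf_nonzero
           in simp_all)
  qed simp
qed (auto intro!: holomorphic_intros)

text \<open>The roots of $x^2 + 11x - 1$ are the values of $R(q)^5$ at cusps.\<close>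

lemma rr_cf_not_cusp:
  assumes r: "norm r < 1" "r \<noteq> 0" and n: "n > 0"
  shows "(rr_cf n r ^ 5)^2 + 11 * rr_cf n r ^ 5 - 1 \<noteq> 0"
proof
  assume cusp: "(rr_cf n r ^ 5)^2 + 11 * rr_cf n r ^ 5 - 1 = 0"
  define x where "x = (\<lambda>k. rr_cf n (r ^ 2 ^ k))"
  have x: "(x k ^ 5)^2 + 11 * x k ^ 5 - 1 = 0" for k
  proof (induction k)
    case 0
    then show ?case
      using cusp by (simp add: x_def)
  next
    case (Suc k)
    have norm: "norm (r ^ 2 ^ k) < 1" and nz: "r ^ 2 ^ k \<noteq> 0" "r ^ 2 ^ Suc k \<noteq> 0"
      and norm': "norm (r ^ 2 ^ Suc k) < 1"
      using r by (simp_all add: norm_power power_less_one_iff del: power_Suc)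
    have "x (Suc k) = rr_cf (2 * n) (r ^ 2 ^ k)"
      by (simp add: x_def rr_cf_power mult_ac)
    with modular_2_cusp[OF rr_cf_modular_2[OF norm n] _ _ Suc[unfolded x_def]] show ?case
      using rr_cf_nonzero[OF norm nz(1)] n by simp
  qed
  have "isCont (rr_cf n) 0"
    using holomorphic_on_imp_continuous_on[OF holomorphic_rr_cf] continuous_on_eq_continuous_at[of "ball 0 1" "rr_cf n"]
    by auto
  moreover have "(\<lambda>k. r ^ 2 ^ k) \<longlonglongrightarrow> 0"
    using LIMSEQ_subseq_LIMSEQ[OF LIMSEQ_power_zero[OF r(1)], of "\<lambda>k. 2 ^ k"]
    by (simp add: o_def strict_mono_def)
  ultimately have "x \<longlonglongrightarrow> rr_cf n 0"
    unfolding x_def by (rule isCont_tendsto_compose)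
  then have "(\<lambda>k. (x k ^ 5)^2 + 11 * x k ^ 5 - 1) \<longlonglongrightarrow> (0 ^ 5)^2 + 11 * 0 ^ 5 - 1"
    using n by (intro tendsto_intros) auto
  then show False
    unfolding x by (simp add: LIMSEQ_const_iff)
qed

section \<open>The five identities\<close>

text \<open>As polynomials in k, the difference of the two sides and the quadratic equation of k
  have the same ratio of constant to leading coefficient. Their proportionality is therefore one
  relation between linear coefficients, free of k, which is proved first.\<close>

lemma level_16_identity:
  fixes a b e h k :: complex
  assumes mod: "h - e^2 - e*h^2*(h + e^2) = 0"
    and quad: "a*(e^2 + a*b) - e*(1 - a*b^2) = 0" "b*(h^2 + b*e) - h*(1 - b*e^2) = 0"
      "e*(k^2 + e*h) - k*(1 - e*h^2) = 0"
    and "e \<noteq> 0"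
  shows "b*(a^2*e*h - 2*a*e*h*k + a^2*k^2) = e^2*h - 2*a*e*k + e*k^2"
proof -
  have "(e - a^2*b)*(1 - e*h^2) - 2*a*e^2*(1 - b*h)
      = (a - a*b*h)*(h - e^2 - e*h^2*(h + e^2))
        + (e*h^2 - 1)*(a*(e^2 + a*b) - e*(1 - a*b^2))
        + (a - a*e*h^2)*(b*(h^2 + b*e) - h*(1 - b*e^2))"
    by algebra
  then have "(e - a^2*b)*(1 - e*h^2) - 2*a*e^2*(1 - b*h) = 0"
    unfolding mod quad by simp
  moreover have "e*(e^2*h - 2*a*e*k + e*k^2 - b*(a^2*e*h - 2*a*e*h*k + a^2*k^2))
      = (e - a^2*b)*(e*(k^2 + e*h) - k*(1 - e*h^2))
        + k*((e - a^2*b)*(1 - e*h^2) - 2*a*e^2*(1 - b*h))"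
    by algebra
  ultimately show ?thesis
    unfolding quad using \<open>e \<noteq> 0\<close> by simp
qed

lemma level_6_identity:
  fixes a b c d :: complex
  assumes "b - a^2 - a*b^2*(b + a^2) = 0"
    and "a^2*d + b*c^2 - b*c*(b + a^2)*(a + d) = 0"
  shows "d*(a^2*c - b*c + a^3*b) = a*b^2*c*(a*b - c + a^3)"
proof -
  have "d*(a^2*c - b*c + a^3*b) - a*b^2*c*(a*b - c + a^3)
      = a*b*(a^2*d + b*c^2 - b*c*(b + a^2)*(a + d)) - c*d*(b - a^2 - a*b^2*(b + a^2))"
    by algebra
  then show ?thesis
    unfolding assms by simp
qed

text \<open>The same comparison of quadratics, now in f: the factor of proportionality is (bd - a^2
  c^2) / c, and \<open>rel\<close> matches the linear coefficients.\<close>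

lemma level_12_identity:
  fixes a b c d f :: complex
  assumes rel: "(b*d - a^2*c^2)*(1 - c*d^2) - 2*a*c^2*d*(1 - b*c) = 0"
    and quad: "c*(f^2 + c*d) - f*(1 - c*d^2) = 0" and "c \<noteq> 0"
  shows "b*d*(c*d + 2*a*c^2*f + f^2) = a*c*(a*c^2*d + 2*d*f + a*c*f^2)"
proof -
  have "c*(b*d*(c*d + 2*a*c^2*f + f^2) - a*c*(a*c^2*d + 2*d*f + a*c*f^2))
      = f*((b*d - a^2*c^2)*(1 - c*d^2) - 2*a*c^2*d*(1 - b*c))
        + (b*d - a^2*c^2)*(c*(f^2 + c*d) - f*(1 - c*d^2))"
    by algebra
  then show ?thesis
    unfolding rel quad using \<open>c \<noteq> 0\<close> by simp
qed

text \<open>The same comparison, now in g. The modular equation gives (d^2 + f)(1 - d f^2) = 2 d^2,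
  which turns \<open>rel\<close> into the equality of the linear coefficients.\<close>

lemma level_24_identity:
  fixes a b c d e f g :: complex
  assumes mod: "f - d^2 - d*f^2*(f + d^2) = 0"
    and quad: "d*(g^2 + d*f) - g*(1 - d*f^2) = 0"
    and rel: "a^2*b*c^2*d + e*f - a*c*(d^2 + f)*(1 + b*e*f^2) = 0" and "d \<noteq> 0"
  shows "a*b*c*d*(a*c*d*f - 2*e*f^2*g + a*c*g^2) = 2*a*c*d*g - e*d*f^2 - e*f*g^2"
proof -
  have "d*(a*b*c*d*(a*c*d*f - 2*e*f^2*g + a*c*g^2) - (2*a*c*d*g - e*d*f^2 - e*f*g^2))
      = (a^2*b*c^2*d + e*f)*(d*(g^2 + d*f) - g*(1 - d*f^2))
        + g*(1 - d*f^2)*(a^2*b*c^2*d + e*f - a*c*(d^2 + f)*(1 + b*e*f^2))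
        + g*a*c*(1 + b*e*f^2)*(f - d^2 - d*f^2*(f + d^2))"
    by algebra
  then show ?thesis
    unfolding mod quad rel using \<open>d \<noteq> 0\<close> by simp
qed

theorem theorem1p3:
  fixes q r :: complex and R :: "nat \<Rightarrow> complex"
  assumes "0 < norm q" and "norm q < 1" and "r ^ 5 = q"
  defines "R \<equiv> rr_R r q"
  shows "1 / (R 2 * R 3) + R 2 * R 3 = 1 + R 1 / R 6 + R 6 / R 1
    \<and> R 2 = ((R 4)^2 * R 8 - 2 * R 1 * R 4 * R 16 + R 4 * (R 16)^2)
          / ((R 1)^2 * R 4 * R 8 - 2 * R 1 * R 4 * R 8 * R 16 + (R 1)^2 * (R 16)^2)
    \<and> R 6 = R 1 * (R 2)^2 * R 3
          * ((R 1 * R 2 - R 3 + (R 1)^3)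
             / ((R 1)^2 * R 3 - R 2 * R 3 + (R 1)^3 * R 2))
    \<and> R 2 = R 1 * R 3 / R 6
          * ((R 1 * (R 3)^2 * R 6 + 2 * R 6 * R 12 + R 1 * R 3 * (R 12)^2)
             / (R 3 * R 6 + 2 * R 1 * (R 3)^2 * R 12 + (R 12)^2))
    \<and> R 2 = 1 / (R 1 * R 3 * R 6)
          * ((2 * R 1 * R 3 * R 6 * R 24 - R 4 * R 6 * (R 12)^2 - R 4 * R 12 * (R 24)^2)
             / (R 1 * R 3 * R 6 * R 12 - 2 * R 4 * (R 12)^2 * R 24 + R 1 * R 3 * (R 24)^2))"
proof -
  have r: "norm r < 1" "r \<noteq> 0"
    using assms by (auto simp: norm_power power_less_one_iff)
  have R: "R n = rr_cf n r" for n
    unfolding R_def using rr_R_eq_rr_cf[of r n] assms(3) by simp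
  have nz: "R n \<noteq> 0" if "n > 0" for n
    unfolding R using rr_cf_nonzero[OF r that] .
  have cusp: "(R n ^ 5)^2 + 11 * R n ^ 5 - 1 \<noteq> 0" if "n > 0" for n
    unfolding R using rr_cf_not_cusp[OF r that] .
  have mod2: "R (2*n) - R n ^ 2 - R n * R (2*n) ^ 2 * (R (2*n) + R n ^ 2) = 0" if "n > 0" for n
    unfolding R using rr_cf_modular_2[OF r(1) that] .
  have mod4: "R n * (R (4*n) ^ 2 + R n * R (2*n)) - R (4*n) * (1 - R n * R (2*n) ^ 2) = 0"
    if "n > 0" for n
    unfolding R using rr_cf_level_4[OF r(1) that] .
  have mod2': "R (2*n) - R n ^ 2 = R n * R (2*n) ^ 2 * (R (2*n) + R n ^ 2)" if "n > 0" for n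
    using mod2[OF that] by simp
  have mod4': "R n * (R (4*n) ^ 2 + R n * R (2*n)) = R (4*n) * (1 - R n * R (2*n) ^ 2)"
    if "n > 0" for n
    using mod4[OF that] by simp
  note level6 = rr_cf_level_6[OF r(1), folded R]

  have "1 / (R 2 * R 3) + R 2 * R 3 = 1 + R 1 / R 6 + R 6 / R 1"
  proof -
    have "R 1 * R 6 + R 1 * R 6 * (R 2 * R 3)^2
        = R 1 * R 6 * (R 2 * R 3) + R 1^2 * (R 2 * R 3) + R 6^2 * (R 2 * R 3)"
      using level6(1) by algebra
    then have "(R 1 * R 6 + R 1 * R 6 * (R 2 * R 3)^2) / (R 1 * R 6 * (R 2 * R 3))
        = (R 1 * R 6 * (R 2 * R 3) + R 1^2 * (R 2 * R 3) + R 6^2 * (R 2 * R 3)) / (R 1 * R 6 * (R 2 * R 3))"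
      by simp
    then show ?thesis
      using nz by (simp add: add_divide_distrib power2_eq_square)
  qed

  moreover have "R 2 = ((R 4)^2 * R 8 - 2 * R 1 * R 4 * R 16 + R 4 * (R 16)^2)
      / ((R 1)^2 * R 4 * R 8 - 2 * R 1 * R 4 * R 8 * R 16 + (R 1)^2 * (R 16)^2)" (is "_ = ?N / ?D")
  proof -
    have eq: "R 2 * ?D = ?N"
      using level_16_identity[of "R 8" "R 4" "R 1" "R 2" "R 16"] mod2[of 4] mod4[of 1] mod4[of 2]
        mod4[of 4] nz by simp
    \<comment> \<open>A zero of \<open>?D\<close> would be one of \<open>?N\<close> as well by the
      cleared equation, and a common zero makes R(q)^5 a root of the cusp polynomial. The remaining
      denominators are treated alike.\<close>
    have "?D \<noteq> 0"
    proof
      assume "?D = 0"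
      moreover from this have "?N = 0"
        using eq by simp
      ultimately show False
        using denominator_level_16_cusp[of "R 4" "R 16" "R 8" "R 1"] mod4'[of 4] mod2'[of 8]
          nz cusp[of 1] by simp
    qed
    then show ?thesis
      using eq by (simp add: eq_divide_eq)
  qed

  moreover have "R 6 = R 1 * (R 2)^2 * R 3 * ((R 1 * R 2 - R 3 + (R 1)^3)
      / ((R 1)^2 * R 3 - R 2 * R 3 + (R 1)^3 * R 2))" (is "_ = ?M * (?N / ?D)")
  proof -
    have eq: "R 6 * ?D = ?M * ?N"
      using level_6_identity[of "R 2" "R 1" "R 6" "R 3"] mod2[of 1] level6(2) by simp
    have "?D \<noteq> 0"
    proof
      assume "?D = 0"
      moreover from this have "?N = 0"
        using eq nz by simp
      ultimately show False
        using denominator_level_6_cusp[of "R 2" "R 1" "R 3"] mod2'[of 1] nz cusp[of 1] by simp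
    qed
    then show ?thesis
      using eq by (simp add: eq_divide_eq)
  qed

  moreover have "R 2 = R 1 * R 3 / R 6
      * ((R 1 * (R 3)^2 * R 6 + 2 * R 6 * R 12 + R 1 * R 3 * (R 12)^2)
         / (R 3 * R 6 + 2 * R 1 * (R 3)^2 * R 12 + (R 12)^2))" (is "_ = _ * (?N / ?D)")
  proof -
    have eq: "R 2 * R 6 * ?D = R 1 * R 3 * ?N"
      using level_12_identity[of "R 2" "R 6" "R 1" "R 3" "R 12"] level6(3) mod4[of 3] nz by simp
    have "?D \<noteq> 0"
    proof
      assume "?D = 0"
      moreover from this have "?N = 0"
        using eq nz by simp
      moreover have "(R 3 - R 1^3) * (1 + R 1 * R 3^3) = 3 * R 1^2 * R 3^2"
        using rr_cf_modular_3[OF r(1), of 1] by (simp add: R)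
      ultimately show False
        using denominator_level_12_cusp[of "R 3" "R 1" "R 6" "R 12"] mod2'[of 3] mod4'[of 3]
          nz cusp[of 1] by simp
    qed
    then show ?thesis
      using eq nz by (simp add: eq_divide_eq mult_ac)
  qed

  moreover have "R 2 = 1 / (R 1 * R 3 * R 6)
      * ((2 * R 1 * R 3 * R 6 * R 24 - R 4 * R 6 * (R 12)^2 - R 4 * R 12 * (R 24)^2)
         / (R 1 * R 3 * R 6 * R 12 - 2 * R 4 * (R 12)^2 * R 24 + R 1 * R 3 * (R 24)^2))"
    (is "_ = _ * (?N / ?D)")
  proof -
    have eq: "R 1 * R 2 * R 3 * R 6 * ?D = ?N"
      using level_24_identity[of "R 12" "R 6" "R 24" "R 1" "R 2" "R 3" "R 4"] mod2[of 6] mod4[of 6]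
        rr_cf_level_12[OF r(1), folded R] nz by simp
    have "?D \<noteq> 0"
    proof
      assume "?D = 0"
      moreover from this have "?N = 0"
        using eq by simp
      ultimately show False
        using denominator_level_24_cusp[of "R 12" "R 6" "R 24" "R 1" "R 3" "R 4"] mod2'[of 6]
          mod2'[of 12] mod4'[of 6] nz cusp[of 12] by simp
    qed
    then show ?thesis
      using eq nz by (simp add: eq_divide_eq mult_ac)
  qed

  ultimately show ?thesis
    by blast
qed

end
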